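(* Let $(G,R)$ be an Abelian cyclically ordered group and $C$ a c-convex subgroup of $G$ which is pure in $G$ and linear (so that $C$, with the total order $x\leq y\iff (x=y$ or $R(0,y-x,2(y-x)))$, is a totally ordered group). Then $(G,R)$ is elementarily equivalent, in the language of cyclically ordered groups, to the lexicographic product $(G/C)\overrightarrow{\times}C$, where $G/C$ carries the quotient cyclic order.
   Context: A cyclically ordered group $(G,R)$ (written additively when Abelian) is a group with a ternary relation $R$ that is strict, total (pairwise distinct $x,y,z$ satisfy $R(x,y,z)$ or $R(x,z,y)$), cyclic ($R(x,y,z)\Rightarrow R(y,z,x)$), transitive ($R(x,y,z)\wedge R(y,u,z)\Rightarrow R(x,u,z)$) and translation invariant. It is linear if $R$ comes from a total group order $\leq$ via $R(x,y,z)$ iff $x<y<z$ or $y<z<x$ or $z<x<y$. c-convex subgroups: $G$ itself; and a proper subgroup $H$ with no element of order $2$ such that $h\in H$, $R(-h,0,h)$, $R(0,g,h)$ imply $g\in H$. Every proper c-convex subgroup is linear. $C$ is pure in $G$ if whenever $h\in C$ and $ng=h$ for some $g\in G$, there is $h'\in C$ with $nh'=h$. Quotient cyclic order on $G/C$: $\overline R(\bar x,\bar y,\bar z)$ iff $\bar x,\bar y,\bar z$ pairwise distinct and $R(x',y',z')$ for some (equivalently all) representatives. Lexicographic product of a c.o.g. $(A,R)$ and a totally ordered group $(B,\leq)$: $A\times B$ with $R'((a,b),(a',b'),(a'',b''))$ iff $R(a,a',a'')$, or ($a=a'\neq a''$ and $b<b'$), or ($a\neq a'=a''$ and $b'<b''$),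 or ($a=a''\neq a'$ and $b''<b$), or ($a=a'=a''$ and ($b<b'<b''$ or $b'<b''<b$ or $b''<b<b'$)). *)

theory Defs
  imports "HOL-Algebra.Multiplicative_Group"
begin

text \<open>
  Groups are those of HOL-Algebra, hence written multiplicatively. The ternary relation is a separate
  argument; only its values on the carrier are ever used.
\<close>

section \<open>Cyclically ordered groups\<close>

locale cyclically_ordered_group = group G for G (structure) +
  fixes R :: "'a \<Rightarrow> 'a \<Rightarrow> 'a \<Rightarrow> bool"
  assumes strict: "\<lbrakk>x \<in> carrier G; y \<in> carrier G; z \<in> carrier G; R x y z\<rbrakk>
      \<Longrightarrow> x \<noteq> y \<and> y \<noteq> z \<and> x \<noteq> z"
    and total: "\<lbrakk>x \<in> carrier G; y \<in> carrier G; z \<in> carrier G; x \<noteq> y; y \<noteq> z; x \<noteq> z\<rbrakk>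
      \<Longrightarrow> R x y z \<or> R x z y"
    and cyclic: "\<lbrakk>x \<in> carrier G; y \<in> carrier G; z \<in> carrier G; R x y z\<rbrakk> \<Longrightarrow> R y z x"
    and transitive: "\<lbrakk>x \<in> carrier G; y \<in> carrier G; z \<in> carrier G; u \<in> carrier G;
      R x y z; R y u z\<rbrakk> \<Longrightarrow> R x u z"
    and translation: "\<lbrakk>x \<in> carrier G; y \<in> carrier G; z \<in> carrier G; u \<in> carrier G; v \<in> carrier G;
      R x y z\<rbrakk> \<Longrightarrow> R (u \<otimes> x \<otimes> v) (u \<otimes> y \<otimes> v) (u \<otimes> z \<otimes> v)"

definition total_group_order :: "('a, 'b) monoid_scheme \<Rightarrow> 'a rel \<Rightarrow> bool" where
  "total_group_order G r \<longleftrightarrow> group G \<and> linear_order_on (carrier G) r \<and>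
     (\<forall>x\<in>carrier G. \<forall>y\<in>carrier G. \<forall>u\<in>carrier G. \<forall>v\<in>carrier G.
        (x, y) \<in> r \<longrightarrow> (u \<otimes>\<^bsub>G\<^esub> x \<otimes>\<^bsub>G\<^esub> v, u \<otimes>\<^bsub>G\<^esub> y \<otimes>\<^bsub>G\<^esub> v) \<in> r)"

definition linear_cyclic_order ::
    "('a, 'b) monoid_scheme \<Rightarrow> ('a \<Rightarrow> 'a \<Rightarrow> 'a \<Rightarrow> bool) \<Rightarrow> bool" where
  "linear_cyclic_order G R \<longleftrightarrow> (\<exists>r. total_group_order G r \<and>
     (\<forall>x\<in>carrier G. \<forall>y\<in>carrier G. \<forall>z\<in>carrier G.
        R x y z \<longleftrightarrow> ((x, y) \<in> r - Id \<and> (y, z) \<in> r - Id) \<or>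
                    ((y, z) \<in> r - Id \<and> (z, x) \<in> r - Id) \<or>
                    ((z, x) \<in> r - Id \<and> (x, y) \<in> r - Id)))"

definition c_convex ::
    "('a, 'b) monoid_scheme \<Rightarrow> ('a \<Rightarrow> 'a \<Rightarrow> 'a \<Rightarrow> bool) \<Rightarrow> 'a set \<Rightarrow> bool" where
  "c_convex G R H \<longleftrightarrow> H = carrier G \<or>
     (subgroup H G \<and> H \<noteq> carrier G \<and> (\<forall>h\<in>H. group.ord G h \<noteq> 2) \<and>
      (\<forall>h\<in>H. \<forall>g\<in>carrier G. R (inv\<^bsub>G\<^esub> h) \<one>\<^bsub>G\<^esub> h \<and> R \<one>\<^bsub>G\<^esub> g h \<longrightarrow> g \<in> H))"

definition pure_in :: "('a, 'b) monoid_scheme \<Rightarrow> 'a set \<Rightarrow> bool" where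
  "pure_in G C \<longleftrightarrow> (\<forall>h\<in>C. \<forall>n::nat. (\<exists>g\<in>carrier G. g [^]\<^bsub>G\<^esub> n = h) \<longrightarrow>
     (\<exists>h'\<in>C. h' [^]\<^bsub>G\<^esub> n = h))"

text \<open>Additively: \<open>x = y\<close> or \<open>R(0, y - x, 2(y - x))\<close>.\<close>

definition induced_order ::
    "('a, 'b) monoid_scheme \<Rightarrow> ('a \<Rightarrow> 'a \<Rightarrow> 'a \<Rightarrow> bool) \<Rightarrow> 'a rel" where
  "induced_order C R = {(x, y). x \<in> carrier C \<and> y \<in> carrier C \<and>
     (x = y \<or> R \<one>\<^bsub>C\<^esub> (y \<otimes>\<^bsub>C\<^esub> inv\<^bsub>C\<^esub> x) ((y \<otimes>\<^bsub>C\<^esub> inv\<^bsub>C\<^esub> x) [^]\<^bsub>C\<^esub> (2::nat)))}"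

definition quotient_cyclic_order ::
    "('a \<Rightarrow> 'a \<Rightarrow> 'a \<Rightarrow> bool) \<Rightarrow> 'a set \<Rightarrow> 'a set \<Rightarrow> 'a set \<Rightarrow> bool" where
  "quotient_cyclic_order R K L M \<longleftrightarrow> K \<noteq> L \<and> L \<noteq> M \<and> K \<noteq> M \<and>
     (\<exists>x\<in>K. \<exists>y\<in>L. \<exists>z\<in>M. R x y z)"

definition lex_cyclic_order ::
    "('a \<Rightarrow> 'a \<Rightarrow> 'a \<Rightarrow> bool) \<Rightarrow> 'b rel \<Rightarrow> 'a \<times> 'b \<Rightarrow> 'a \<times> 'b \<Rightarrow> 'a \<times> 'b \<Rightarrow> bool" where
  "lex_cyclic_order R r = (\<lambda>(a, b) (a', b') (a'', b'').
     R a a' a'' \<or>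
     (a = a' \<and> a' \<noteq> a'' \<and> (b, b') \<in> r - Id) \<or>
     (a \<noteq> a' \<and> a' = a'' \<and> (b', b'') \<in> r - Id) \<or>
     (a = a'' \<and> a'' \<noteq> a' \<and> (b'', b) \<in> r - Id) \<or>
     (a = a' \<and> a' = a'' \<and>
       (((b, b') \<in> r - Id \<and> (b', b'') \<in> r - Id) \<or>
        ((b', b'') \<in> r - Id \<and> (b'', b) \<in> r - Id) \<or>
        ((b'', b) \<in> r - Id \<and> (b, b') \<in> r - Id))))"

section \<open>The first-order language of cyclically ordered groups\<close>

datatype cog_term =
  Var nat | Zero | Plus cog_term cog_term | Minus cog_term

datatype cog_formula =
  Equal cog_term cog_term
| Cyc cog_term cog_term cog_term
| Neg cog_formula
| Conj cog_formula cog_formula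
| Exists nat cog_formula

primrec term_vars :: "cog_term \<Rightarrow> nat set" where
  "term_vars (Var i) = {i}"
| "term_vars Zero = {}"
| "term_vars (Plus s t) = term_vars s \<union> term_vars t"
| "term_vars (Minus t) = term_vars t"

primrec free_vars :: "cog_formula \<Rightarrow> nat set" where
  "free_vars (Equal s t) = term_vars s \<union> term_vars t"
| "free_vars (Cyc s t u) = term_vars s \<union> term_vars t \<union> term_vars u"
| "free_vars (Neg \<phi>) = free_vars \<phi>"
| "free_vars (Conj \<phi> \<psi>) = free_vars \<phi> \<union> free_vars \<psi>"
| "free_vars (Exists i \<phi>) = free_vars \<phi> - {i}"

definition sentence :: "cog_formula \<Rightarrow> bool" where
  "sentence \<phi> \<longleftrightarrow> free_vars \<phi> = {}"

primrec term_val :: "('a, 'b) monoid_scheme \<Rightarrow> (nat \<Rightarrow> 'a) \<Rightarrow> cog_term \<Rightarrow> 'a" where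
  "term_val G e (Var i) = e i"
| "term_val G e Zero = \<one>\<^bsub>G\<^esub>"
| "term_val G e (Plus s t) = term_val G e s \<otimes>\<^bsub>G\<^esub> term_val G e t"
| "term_val G e (Minus t) = inv\<^bsub>G\<^esub> (term_val G e t)"

primrec sat :: "('a, 'b) monoid_scheme \<Rightarrow> ('a \<Rightarrow> 'a \<Rightarrow> 'a \<Rightarrow> bool) \<Rightarrow>
    (nat \<Rightarrow> 'a) \<Rightarrow> cog_formula \<Rightarrow> bool" where
  "sat G R e (Equal s t) \<longleftrightarrow> term_val G e s = term_val G e t"
| "sat G R e (Cyc s t u) \<longleftrightarrow> R (term_val G e s) (term_val G e t) (term_val G e u)"
| "sat G R e (Neg \<phi>) \<longleftrightarrow> \<not> sat G R e \<phi>"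
| "sat G R e (Conj \<phi> \<psi>) \<longleftrightarrow> sat G R e \<phi> \<and> sat G R e \<psi>"
| "sat G R e (Exists i \<phi>) \<longleftrightarrow> (\<exists>a\<in>carrier G. sat G R (e(i := a)) \<phi>)"

definition models ::
    "('a, 'b) monoid_scheme \<Rightarrow> ('a \<Rightarrow> 'a \<Rightarrow> 'a \<Rightarrow> bool) \<Rightarrow> cog_formula \<Rightarrow> bool" where
  "models G R \<phi> \<longleftrightarrow> (\<forall>e. range e \<subseteq> carrier G \<longrightarrow> sat G R e \<phi>)"

definition elementarily_equivalent ::
    "('a, 'b) monoid_scheme \<Rightarrow> ('a \<Rightarrow> 'a \<Rightarrow> 'a \<Rightarrow> bool) \<Rightarrow>
     ('c, 'd) monoid_scheme \<Rightarrow> ('c \<Rightarrow> 'c \<Rightarrow> 'c \<Rightarrow> bool) \<Rightarrow> bool" where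
  "elementarily_equivalent G R H S \<longleftrightarrow>
     (\<forall>\<phi>. sentence \<phi> \<longrightarrow> (models G R \<phi> \<longleftrightarrow> models H S \<phi>))"

end

theory Submission
  imports Defs "HOL-Algebra.Product_Groups"
begin

text \<open>
  Let \<open>U\<close> be a nonprincipal ultrafilter on the natural numbers. The ultrapower of \<open>C\<close> is a pure, torsion-free and,
  being countably saturated, algebraically compact subgroup of the ultrapower of \<open>G\<close>, hence a direct
  summand. As \<open>C\<close> is c-convex, the cyclic order is determined by the cosets of \<open>C\<close> and the differences
  inside them, so the splitting is an isomorphism of the ultrapower of \<open>G\<close> onto the lexicographic
  product of the ultrapowers of \<open>G/C\<close> and \<open>C\<close>, which is the ultrapower of the lexicographic product.
  The elementary equivalence then follows as in the theorem of Los.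
\<close>

section \<open>Splitting off pure algebraically compact subgroups\<close>

text \<open>A pure subgroup need not be a direct summand, so \<open>G\<close> itself need not split
  over \<open>C\<close>; the ultrapower supplies the missing limits. The exponents by which an
  element is divisible modulo a subgroup are closed under least common multiples and so have a
  countable cofinal chain. Limits of sequences therefore suffice whatever the cardinality of
  \<open>G\<close>, and the natural numbers can serve as index set.

  The obstacle in the splitting is that a subgroup \<open>K\<close> maximal with trivial
  intersection with \<open>B\<close> need not be a complement: for the p-adic integers Z_p, the
  pairs (x, p x) form such a subgroup for the first summand of Z_p + Z_p. The Zorn argument
  therefore also keeps the quotient by \<open>B <#> K\<close> torsion-free, which is what
  \<open>isolated\<close> expresses.

  The subgroup \<open>N\<close> will be that of the sequences equal to one almost everywhere;
  splitting modulo \<open>N\<close> takes place inside the full product group.\<close>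

definition isolated :: "('a, 'b) monoid_scheme \<Rightarrow> 'a set \<Rightarrow> bool" where
  "isolated G H \<longleftrightarrow> (\<forall>m\<in>carrier G. \<forall>n::int. n > 0 \<longrightarrow> m [^]\<^bsub>G\<^esub> n \<in> H \<longrightarrow> m \<in> H)"

text \<open>Algebraic compactness of \<open>B/N\<close>, in the form it takes for torsion-free groups: a sequence that is
  Cauchy with respect to a divisibility chain \<open>L\<close> has a limit.\<close>

definition chain_complete :: "('a, 'b) monoid_scheme \<Rightarrow> 'a set \<Rightarrow> 'a set \<Rightarrow> bool" where
  "chain_complete G N B \<longleftrightarrow> (\<forall>(x :: nat \<Rightarrow> 'a) (L :: nat \<Rightarrow> int).
     (\<forall>n. x n \<in> B) \<longrightarrow> (\<forall>n. L n > 0 \<and> L n dvd L (Suc n)) \<longrightarrow>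
     (\<forall>n. \<exists>b\<in>B. x (Suc n) \<otimes>\<^bsub>G\<^esub> inv\<^bsub>G\<^esub> (x n) \<otimes>\<^bsub>G\<^esub> b [^]\<^bsub>G\<^esub> L n \<in> N) \<longrightarrow>
     (\<exists>y\<in>B. \<forall>n. \<exists>b\<in>B. y \<otimes>\<^bsub>G\<^esub> inv\<^bsub>G\<^esub> (x n) \<otimes>\<^bsub>G\<^esub> b [^]\<^bsub>G\<^esub> L n \<in> N))"

context comm_group
begin

text \<open>Bezout for the coprime cofactors \<open>a'\<close> and \<open>b'\<close> writes
  \<open>g\<close> as a product of powers of \<open>g [^] a'\<close> and \<open>g [^] b'\<close>.
  Since \<open>b * a'\<close> and \<open>a * b'\<close> both equal \<open>lcm a b\<close>, each
  factor is an element of \<open>S\<close> times an \<open>lcm a b\<close>-th power.\<close>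

lemma lcm_pow_mod_subgroup:
  fixes a b :: int
  assumes S: "subgroup S G" and a: "a > 0" and b: "b > 0"
    and s: "s \<in> S" "t \<in> S" and m: "x \<in> carrier G" "y \<in> carrier G"
    and g: "g = s \<otimes> x [^] a" "g = t \<otimes> y [^] b"
  shows "\<exists>r\<in>S. \<exists>z\<in>carrier G. g = r \<otimes> z [^] lcm a b"
proof -
  obtain a' b' where ab: "a = a' * gcd a b" "b = b' * gcd a b" and cop: "coprime a' b'"
    using gcd_coprime_exists[of a b] a by auto
  obtain u v where uv: "u * a' + v * b' = 1"
    using bezout_int[of a' b'] cop by auto
  have d: "gcd a b > 0" using a by (simp add: gcd_pos_int)
  have "lcm a b * gcd a b = (a * b') * gcd a b"
    using lcm_gcd_prod[of a b] a b ab by (simp add: mult.assoc)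
  then have L1: "lcm a b = a * b'" using d by (metis less_irrefl mult_right_cancel)
  have "a * b' = b * a'" using ab by (metis mult.assoc mult.commute)
  then have L2: "lcm a b = b * a'" using L1 by simp
  have c [simp]: "s \<in> carrier G" "t \<in> carrier G" "x \<in> carrier G" "y \<in> carrier G" "g \<in> carrier G"
    using s m g subgroup.mem_carrier[OF S] by auto
  have "g = g [^] (u * a' + v * b')" using uv by simp
  also have "\<dots> = g [^] (a' * u) \<otimes> g [^] (b' * v)"
    by (simp add: int_pow_mult mult.commute)
  also have "g [^] (a' * u) = t [^] (a' * u) \<otimes> y [^] (lcm a b * u)"
    unfolding g(2) by (simp add: int_pow_distrib int_pow_pow L2 mult.assoc)
  also have "g [^] (b' * v) = s [^] (b' * v) \<otimes> x [^] (lcm a b * v)"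
    unfolding g(1) by (simp add: int_pow_distrib int_pow_pow L1 mult.assoc)
  finally have "g = (t [^] (a' * u) \<otimes> s [^] (b' * v)) \<otimes> (y [^] u \<otimes> x [^] v) [^] lcm a b"
    by (simp add: int_pow_distrib int_pow_pow mult.commute m_ac)
  moreover have "t [^] (a' * u) \<otimes> s [^] (b' * v) \<in> S"
    using subgroup_int_pow_closed[OF S] subgroup.m_closed[OF S] s by simp
  moreover have "y [^] u \<otimes> x [^] v \<in> carrier G" by simp
  ultimately show ?thesis by blast
qed

lemma isolatedD:
  assumes S: "subgroup S G" and iso: "isolated G S"
    and "m \<in> carrier G" "n \<noteq> (0::int)" "m [^] n \<in> S"
  shows "m \<in> S"
proof (cases "n > 0")
  case True
  then show ?thesis using iso assms(3,5) unfolding isolated_def by blast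
next
  case False
  have "m [^] (- n) \<in> S"
    using assms by (simp add: int_pow_neg subgroup.m_inv_closed)
  moreover have "- n > 0" using False assms(4) by simp
  ultimately show ?thesis using iso assms(3) unfolding isolated_def by blast
qed

lemma set_mult_memI: "b \<in> B \<Longrightarrow> k \<in> K \<Longrightarrow> b \<otimes> k \<in> B <#> K"
  by (auto simp: set_mult_def)

lemma set_mult_memE:
  assumes "x \<in> B <#> K" obtains b k where "b \<in> B" "k \<in> K" "x = b \<otimes> k"
  using assms by (auto simp: set_mult_def)

text \<open>These are the elements with a positive power in the subgroup generated by
  \<open>K\<close> and \<open>h\<close>; for trivial \<open>h\<close> they are the torsion modulo
  \<open>K\<close>.\<close>

lemma pure_closure_subgroup:
  assumes K: "subgroup K G" and h: "h \<in> carrier G"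
  shows "subgroup {m \<in> carrier G. \<exists>p>0. \<exists>j::int. m [^] (p::int) \<otimes> h [^] j \<in> K} G" (is "subgroup ?K' G")
proof
  show "?K' \<subseteq> carrier G" by auto
  show "\<one> \<in> ?K'" using subgroup.one_closed[OF K] h by (simp add: exI[of _ "1::int"] exI[of _ "0::int"])
next
  fix x y assume "x \<in> ?K'" "y \<in> ?K'"
  then obtain p i q j where xy [simp]: "x \<in> carrier G" "y \<in> carrier G" and pq: "p > 0" "q > 0"
    and k: "x [^] (p::int) \<otimes> h [^] (i::int) \<in> K" "y [^] (q::int) \<otimes> h [^] (j::int) \<in> K" by auto
  have "(x \<otimes> y) [^] (p * q) \<otimes> h [^] (i * q + j * p)
      = (x [^] p \<otimes> h [^] i) [^] q \<otimes> (y [^] q \<otimes> h [^] j) [^] p"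
    using h by (simp add: int_pow_distrib int_pow_pow int_pow_mult mult.commute m_ac)
  also have "\<dots> \<in> K" using k K by (meson subgroup.m_closed subgroup_int_pow_closed)
  finally show "x \<otimes> y \<in> ?K'" using pq xy mult_pos_pos[OF pq] by blast
next
  fix x assume "x \<in> ?K'"
  then obtain p i where x [simp]: "x \<in> carrier G" and p: "p > 0"
    and k: "x [^] (p::int) \<otimes> h [^] (i::int) \<in> K" by auto
  have "inv x [^] p \<otimes> h [^] (- i) = inv (x [^] p \<otimes> h [^] i)"
    using h by (simp add: int_pow_inv int_pow_neg inv_mult)
  also have "\<dots> \<in> K" using k K by (meson subgroup.m_inv_closed)
  finally show "inv x \<in> ?K'" using p x by blast
qed

lemma mult_eq_mult_imp_div_eq:
  assumes "a \<in> carrier G" "b \<in> carrier G" "c \<in> carrier G" "d \<in> carrier G" and "a \<otimes> b = c \<otimes> d"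
  shows "b \<otimes> inv d = c \<otimes> inv a"
proof -
  have "b \<otimes> inv d = inv a \<otimes> (a \<otimes> b) \<otimes> inv d" using assms(1-4) by (simp add: m_assoc[symmetric])
  also have "\<dots> = c \<otimes> inv a \<otimes> (d \<otimes> inv d)" unfolding assms(5) using assms(1-4) by (simp only: m_ac m_closed inv_closed)
  finally show ?thesis using assms(1-4) by simp
qed

text \<open>Adjoining \<open>g\<close> as it stands could destroy isolation: a root of
  \<open>g\<close> modulo \<open>B <#> K\<close> need not lie in \<open>B <#> K'\<close>. Changing
  \<open>g\<close> by a suitable element of \<open>B\<close> turns each of its divisibilities modulo
  \<open>B <#> K\<close> into one modulo \<open>K\<close>, so that \<open>K'\<close> can take up the
  roots.\<close>

lemma complement_step:
  assumes K: "subgroup K G" and N: "subgroup N G" and B: "subgroup B G"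
    and NK: "N \<subseteq> K" and KB: "K \<inter> B \<subseteq> N"
    and iso: "isolated G (B <#> K)"
    and tf: "\<forall>b\<in>B. \<forall>n::int. n > 0 \<longrightarrow> b [^] n \<in> N \<longrightarrow> b \<in> N"
    and complete: "chain_complete G N B"
    and g: "g \<in> carrier G" "g \<notin> B <#> K"
  shows "\<exists>K'. subgroup K' G \<and> K \<subset> K' \<and> K' \<inter> B \<subseteq> N \<and> isolated G (B <#> K')"
proof -
  let ?S = "B <#> K"
  have S: "subgroup ?S G" by (rule mult_subgroups[OF B K])
  have BS: "B \<subseteq> ?S" and KS: "K \<subseteq> ?S"
    using subgroup.one_closed[OF B] subgroup.one_closed[OF K] subgroup.mem_carrier[OF B] subgroup.mem_carrier[OF K]
    by (force simp: set_mult_def)+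
  note c [simp] = subgroup.mem_carrier[OF S] subgroup.mem_carrier[OF B] subgroup.mem_carrier[OF K]
  have isoP: "m \<in> ?S" if "m \<in> carrier G" "n > 0" "m [^] n \<in> ?S" for m and n :: int
    using iso that unfolding isolated_def by blast
  note SI = subgroup.m_closed[OF S] subgroup.m_inv_closed[OF S] subgroup_int_pow_closed[OF S]
  note KI = subgroup.m_closed[OF K] subgroup.m_inv_closed[OF K] subgroup_int_pow_closed[OF K]
  note BI = subgroup.m_closed[OF B] subgroup.m_inv_closed[OF B] subgroup_int_pow_closed[OF B]
  \<comment> \<open>As \<open>E\<close> is closed under least common multiples, the chain \<open>L\<close> is cofinal in it, and one limit
    \<open>y\<close> along \<open>L\<close> moves \<open>g\<close> to an element \<open>h\<close> divisible modulo \<open>K\<close> by all of \<open>E\<close> at once.\<close>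
  define E where "E = {n::int. n > 0 \<and> (\<exists>s\<in>?S. \<exists>m\<in>carrier G. g = s \<otimes> m [^] n)}"
  have E_lcm: "lcm a b \<in> E" if ab: "a \<in> E" "b \<in> E" for a b
  proof -
    obtain s t x y where "s \<in> ?S" "t \<in> ?S" "x \<in> carrier G" "y \<in> carrier G"
      "g = s \<otimes> x [^] a" "g = t \<otimes> y [^] b" and pos: "a > 0" "b > 0"
      using ab by (auto simp: E_def)
    with lcm_pow_mod_subgroup[OF S pos] have "\<exists>r\<in>?S. \<exists>z\<in>carrier G. g = r \<otimes> z [^] lcm a b" by blast
    then show ?thesis using pos by (auto simp: E_def lcm_pos_int)
  qed
  have "g = \<one> \<otimes> g [^] (1::int)" using g by simp
  then have E1: "1 \<in> E" using g subgroup.one_closed[OF S] by (auto simp only: E_def)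
  \<comment> \<open>\<open>L n\<close> is the least common multiple of the members of
    \<open>E\<close> among 1, ..., \<open>n\<close>, so each \<open>p\<close> in \<open>E\<close>
    divides \<open>L (nat p)\<close>.\<close>
  define L where "L = rec_nat (1::int) (\<lambda>n l. if int (Suc n) \<in> E then lcm l (int (Suc n)) else l)"
  have L0: "L 0 = 1" and LS: "L (Suc n) = (if int (Suc n) \<in> E then lcm (L n) (int (Suc n)) else L n)" for n
    by (simp_all add: L_def del: of_nat_Suc)
  have LE: "L n \<in> E" for n
    by (induction n) (use E1 E_lcm in \<open>auto simp: L0 LS simp del: of_nat_Suc\<close>)
  then have Lpos: "L n > 0" for n by (auto simp: E_def)
  have Ldvd: "L n dvd L (Suc n)" for n by (simp add: LS)
  have EL: "p dvd L (nat p)" if "p \<in> E" for p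
  proof -
    have "p > 0" using that by (simp add: E_def)
    then obtain n where "p = int (Suc n)" by (metis zero_less_imp_eq_int gr0_implies_Suc)
    then show ?thesis using that by (simp add: LS del: of_nat_Suc)
  qed
  have "\<exists>x k m. x \<in> B \<and> k \<in> K \<and> m \<in> carrier G \<and> g = x \<otimes> k \<otimes> m [^] L n" for n
    using LE[of n] by (auto simp: E_def elim!: set_mult_memE)
  then obtain x k m where xB: "x n \<in> B" and kK: "k n \<in> K" and mG: "m n \<in> carrier G"
    and gx: "g = x n \<otimes> k n \<otimes> m n [^] L n" for n by metis
  note [simp] = c(2)[OF xB] c(3)[OF kK] mG
  have cauchy: "\<exists>b\<in>B. x (Suc n) \<otimes> inv (x n) \<otimes> b [^] L n \<in> N" for n
  proof -
    obtain q where q: "L (Suc n) = L n * q" using Ldvd[of n] by (auto simp: dvd_def)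
    \<comment> \<open>Comparing the representations of \<open>g\<close> at levels \<open>n\<close>
      and \<open>Suc n\<close> puts the \<open>L n\<close>-th power of \<open>w\<close> into
      \<open>B <#> K\<close>. Isolation gives \<open>w\<close> itself there, and its
      \<open>B\<close>-part is the required \<open>b\<close>.\<close>
    define w where "w = m (Suc n) [^] q \<otimes> inv (m n)"
    have w [simp]: "w \<in> carrier G" by (simp add: w_def)
    have "w [^] L n = m (Suc n) [^] L (Suc n) \<otimes> inv (m n [^] L n)"
      by (simp add: w_def q int_pow_distrib int_pow_pow int_pow_inv mult.commute)
    also have "\<dots> = x n \<otimes> k n \<otimes> inv (x (Suc n) \<otimes> k (Suc n))"
      by (rule mult_eq_mult_imp_div_eq) (use gx[of n] gx[of "Suc n"] in simp_all)
    also have "\<dots> = x n \<otimes> k n \<otimes> inv (x (Suc n)) \<otimes> inv (k (Suc n))"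
      by (simp add: inv_mult m_assoc)
    finally have wL: "w [^] L n = x n \<otimes> k n \<otimes> inv (x (Suc n)) \<otimes> inv (k (Suc n))" .
    have "w [^] L n \<in> ?S" unfolding wL using xB kK SI BS KS by (meson subsetD)
    then have "w \<in> ?S" by (rule isoP[OF w Lpos])
    then obtain b l where b: "b \<in> B" "l \<in> K" "w = b \<otimes> l" by (rule set_mult_memE)
    have "x (Suc n) \<otimes> inv (x n) \<otimes> b [^] L n \<in> B" using b xB BI by meson
    moreover
    have "b [^] L n = w [^] L n \<otimes> inv (l [^] L n)" using b
      by (simp add: int_pow_distrib m_assoc)
    then have "x (Suc n) \<otimes> inv (x n) \<otimes> b [^] L n =
      (x (Suc n) \<otimes> inv (x (Suc n))) \<otimes> (x n \<otimes> inv (x n)) \<otimes> (k n \<otimes> inv (k (Suc n)) \<otimes> inv (l [^] L n))"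
      unfolding wL using b by (simp only: m_ac m_closed inv_closed int_pow_closed c(2)[OF xB] c(3)[OF kK] c(3)[OF b(2)])
    then have "x (Suc n) \<otimes> inv (x n) \<otimes> b [^] L n = k n \<otimes> inv (k (Suc n)) \<otimes> inv (l [^] L n)"
      using b by simp
    moreover have "\<dots> \<in> K" using b kK KI by meson
    ultimately have "x (Suc n) \<otimes> inv (x n) \<otimes> b [^] L n \<in> K \<inter> B" by simp
    then show ?thesis using b(1) KB by blast
  qed
  obtain y where y: "y \<in> B" and lim: "\<exists>b\<in>B. y \<otimes> inv (x n) \<otimes> b [^] L n \<in> N" for n
    using complete[unfolded chain_complete_def, THEN spec, THEN spec, of x L] xB Lpos Ldvd cauchy by blast
  define h where "h = g \<otimes> inv y"
  have h [simp]: "h \<in> carrier G" using g y by (simp add: h_def)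
  have gh: "g = h \<otimes> y" using g y by (simp add: h_def m_assoc)
  have hS: "h \<notin> ?S" using g gh y BS SI by (metis subsetD)
  have hE: "\<exists>r\<in>K. \<exists>z\<in>carrier G. h = r \<otimes> z [^] p" if p: "p \<in> E" for p
  proof -
    obtain q where q: "L (nat p) = p * q" using EL[OF p] by (auto simp: dvd_def)
    let ?n = "nat p"
    obtain b where b: "b \<in> B" "y \<otimes> inv (x ?n) \<otimes> b [^] L ?n \<in> N" using lim by blast
    \<comment> \<open>The error of the limit at level \<open>p\<close> lies in \<open>N\<close>,
      hence in \<open>K\<close>, and is absorbed by the coefficient.\<close>
    let ?r = "k ?n \<otimes> inv (y \<otimes> inv (x ?n) \<otimes> b [^] L ?n)"
    have r: "?r \<in> K" using b kK KI NK by (meson subsetD)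
    have "?r \<otimes> (m ?n \<otimes> b) [^] L ?n =
       (k ?n \<otimes> x ?n \<otimes> m ?n [^] L ?n \<otimes> inv y) \<otimes> (b [^] L ?n \<otimes> inv (b [^] L ?n))"
      using b y by (simp only: int_pow_distrib inv_mult inv_inv m_ac m_closed inv_closed int_pow_closed c(2)[OF xB] c(3)[OF kK] mG c(2))
    also have "\<dots> = h" unfolding h_def using b y by (subst gx[of ?n]) (simp add: m_ac)
    finally have "h = ?r \<otimes> ((m ?n \<otimes> b) [^] q) [^] p" using b by (simp add: q int_pow_pow mult.commute)
    moreover have "(m ?n \<otimes> b) [^] q \<in> carrier G" using b by simp
    ultimately show ?thesis using r by blast
  qed
  define K' where "K' = {m \<in> carrier G. \<exists>p>0. \<exists>j::int. m [^] (p::int) \<otimes> h [^] j \<in> K}"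
  have K': "subgroup K' G" unfolding K'_def by (rule pure_closure_subgroup[OF K h])
  have K'I: "m \<in> K'" if "m \<in> carrier G" "p > 0" "m [^] p \<otimes> h [^] j \<in> K" for m and p j :: int
    using that by (auto simp: K'_def)
  have "h \<in> K'" using K'I[of h 1 "-1"] subgroup.one_closed[OF K] by (simp add: int_pow_neg)
  moreover have "K \<subseteq> K'" using K'I[of _ 1 0] by auto
  ultimately have "K \<subset> K'" using hS KS by auto
  moreover have "K' \<inter> B \<subseteq> N"
  proof
    fix b assume "b \<in> K' \<inter> B"
    then obtain p j :: int where b: "b \<in> B" and p: "p > 0" and bh: "b [^] p \<otimes> h [^] j \<in> K" by (auto simp: K'_def)
    have "h [^] j = inv (b [^] p) \<otimes> (b [^] p \<otimes> h [^] j)" using b by (simp add: m_assoc[symmetric])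
    also have "\<dots> \<in> ?S" using b bh BS KS SI by (meson subsetD)
    \<comment> \<open>\<open>h\<close> has infinite order modulo the isolated subgroup
      \<open>B <#> K\<close>.\<close>
    finally have "j = 0" using isolatedD[OF S iso h] hS by blast
    then have "b [^] p \<in> K \<inter> B" using b bh BI by simp
    then show "b \<in> N" using KB tf b p by blast
  qed
  moreover have "m \<in> B <#> K'" if m [simp]: "m \<in> carrier G" and n: "n > 0" and mn: "m [^] n \<in> B <#> K'" for m and n :: int
  proof -
    obtain b k' where b: "b \<in> B" and k': "k' \<in> K'" and mn: "m [^] n = b \<otimes> k'" using mn by (rule set_mult_memE)
    obtain q j :: int where q: "q > 0" and k'G [simp]: "k' \<in> carrier G" and kh: "k' [^] q \<otimes> h [^] j \<in> K" using k' by (auto simp: K'_def)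
    define p where "p = n * q"
    have p: "p > 0" using n q by (simp add: p_def)
    have "m [^] p = b [^] q \<otimes> k' [^] q" using b by (simp add: p_def int_pow_pow[symmetric] mn int_pow_distrib)
    then have "m [^] p \<otimes> h [^] j = b [^] q \<otimes> (k' [^] q \<otimes> h [^] j)" using b by (simp add: m_assoc)
    also have "\<dots> \<in> ?S" using b kh BS KS SI by (meson subsetD)
    finally have mh: "m [^] p \<otimes> h [^] j \<in> ?S" .
    \<comment> \<open>Cancelling the common factor of the exponents keeps
      \<open>m [^] p' \<otimes> h [^] j'\<close> in \<open>B <#> K\<close> by isolation. Coprimality
      then makes \<open>h\<close> a \<open>p'\<close>-th power modulo \<open>B <#> K\<close>, which
      puts \<open>p'\<close> into \<open>E\<close>.\<close>
    obtain p' j' where pj: "p = p' * gcd p j" "j = j' * gcd p j" and cop: "coprime p' j'"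
      using gcd_coprime_exists[of p j] p by auto
    obtain u v where uv: "u * p' + v * j' = 1"
      using bezout_int[of p' j'] cop by auto
    have d: "gcd p j > 0" using p by (simp add: gcd_pos_int)
    have p': "p' > 0" using p d pj by (metis zero_less_mult_pos2)
    let ?s = "m [^] p' \<otimes> h [^] j'"
    have "?s [^] gcd p j = m [^] p \<otimes> h [^] j"
      using pj by (simp add: int_pow_distrib int_pow_pow)
    then have s: "?s \<in> ?S" using isoP[of ?s "gcd p j"] d mh by (simp only:) simp
    have "h [^] (v * j') = ?s [^] v \<otimes> (inv m [^] v) [^] p'"
      by (simp add: int_pow_distrib int_pow_pow int_pow_inv m_ac mult.commute)
    moreover have "h = h [^] (v * j') \<otimes> (h [^] u) [^] p'"
      by (simp add: int_pow_pow int_pow_mult[symmetric] uv add.commute)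
    ultimately have "h = ?s [^] v \<otimes> (inv m [^] v) [^] p' \<otimes> (h [^] u) [^] p'" by simp
    then have "g = (y \<otimes> ?s [^] v) \<otimes> (inv m [^] v \<otimes> h [^] u) [^] p'"
      using y gh by (simp add: int_pow_distrib m_ac)
    moreover have "y \<otimes> ?s [^] v \<in> ?S" using y BS s SI by (meson subsetD)
    moreover have "inv m [^] v \<otimes> h [^] u \<in> carrier G" by simp
    ultimately have "p' \<in> E" unfolding E_def using p' by blast
    \<comment> \<open>By the choice of \<open>y\<close> the root of \<open>h\<close> exists modulo
      \<open>K\<close>, not only modulo \<open>B <#> K\<close>. The factor \<open>z [^] j'\<close>
      corrects \<open>m\<close> to an element of \<open>B <#> K\<close>, and undoing the correction
      costs only an element of \<open>K'\<close>.\<close>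
    then obtain r z where r: "r \<in> K" and z [simp]: "z \<in> carrier G" and hr: "h = r \<otimes> z [^] p'" using hE by blast
    have hj: "h [^] j' = r [^] j' \<otimes> z [^] (p' * j')" using r by (simp add: hr int_pow_distrib int_pow_pow)
    have "?s \<otimes> inv (r [^] j') = m [^] p' \<otimes> z [^] (p' * j') \<otimes> (r [^] j' \<otimes> inv (r [^] j'))"
      unfolding hj using r by (simp only: m_ac m_closed inv_closed int_pow_closed c(3) m z)
    then have "(m \<otimes> z [^] j') [^] p' = ?s \<otimes> inv (r [^] j')"
      using r by (simp add: int_pow_distrib int_pow_pow mult.commute)
    also have "\<dots> \<in> ?S" using s r KS SI by (meson subsetD)
    finally have "m \<otimes> z [^] j' \<in> ?S" by (rule isoP[OF _ p', rotated]) simp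
    then obtain b' l where b': "b' \<in> B" and l: "l \<in> K" and mz: "m \<otimes> z [^] j' = b' \<otimes> l" by (rule set_mult_memE)
    have "m = b' \<otimes> l \<otimes> inv (z [^] j')" using b' l mz
      by (metis c(2,3) int_pow_closed inv_solve_right m m_closed z)
    then have "m = b' \<otimes> (l \<otimes> inv (z [^] j'))" using b' l by (simp add: m_assoc)
    moreover have "(l \<otimes> inv (z [^] j')) [^] p' \<otimes> h [^] j' = l [^] p' \<otimes> inv (z [^] (p' * j')) \<otimes> h [^] j'"
      using l by (simp add: int_pow_distrib int_pow_pow int_pow_inv mult.commute)
    then have "(l \<otimes> inv (z [^] j')) [^] p' \<otimes> h [^] j' = l [^] p' \<otimes> r [^] j' \<otimes> (z [^] (p' * j') \<otimes> inv (z [^] (p' * j')))"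
      unfolding hj using l r by (simp only: m_ac m_closed inv_closed int_pow_closed c(3) z)
    then have "(l \<otimes> inv (z [^] j')) [^] p' \<otimes> h [^] j' \<in> K" using l r KI by simp
    then have "l \<otimes> inv (z [^] j') \<in> K'" using l p' K'I by simp
    ultimately show ?thesis using b' by (metis set_mult_memI)
  qed
  then have "isolated G (B <#> K')" unfolding isolated_def by blast
  ultimately show ?thesis using K' by blast
qed

text \<open>The Zorn argument need not be able to start from \<open>N\<close>, since the quotient by
  \<open>B\<close> may have torsion. Purity lifts that torsion: a power of \<open>m\<close> in
  \<open>B\<close> agrees modulo \<open>N\<close> with the same power of some \<open>a\<close> in
  \<open>B\<close>, and then \<open>inv a \<otimes> m\<close> is torsion modulo
  \<open>N\<close>.\<close>

lemma torsion_isolated: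
  assumes N: "subgroup N G" and B: "subgroup B G" and NB: "N \<subseteq> B"
    and pure: "\<And>g n::int. g \<in> carrier G \<Longrightarrow> n > 0 \<Longrightarrow> g [^] n \<in> B \<Longrightarrow> \<exists>b\<in>B. g [^] n \<otimes> inv (b [^] n) \<in> N"
  defines "T \<equiv> {m \<in> carrier G. \<exists>n>0. m [^] (n::int) \<in> N}"
  shows "subgroup T G" "isolated G (B <#> T)"
proof -
  have "T = {m \<in> carrier G. \<exists>p>0. \<exists>j::int. m [^] (p::int) \<otimes> \<one> [^] j \<in> N}"
    unfolding T_def by auto
  then show T: "subgroup T G" using pure_closure_subgroup[OF N one_closed] by simp
  show "isolated G (B <#> T)" unfolding isolated_def
  proof (intro ballI allI impI)
    fix m and n :: int
    assume m [simp]: "m \<in> carrier G" and n: "n > 0" and "m [^] n \<in> B <#> T"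
    then obtain b t where b: "b \<in> B" and t: "t \<in> T" and mn: "m [^] n = b \<otimes> t" by (auto elim: set_mult_memE)
    obtain q :: int where q: "q > 0" and tq: "t [^] q \<in> N" and [simp]: "t \<in> carrier G" using t by (auto simp: T_def)
    have [simp]: "b \<in> carrier G" using b B by (meson subgroup.mem_carrier)
    have "m [^] (n * q) = b [^] q \<otimes> t [^] q" by (simp add: int_pow_pow[symmetric] mn int_pow_distrib)
    also have "\<dots> \<in> B" using b tq NB B by (meson subgroup.m_closed subgroup_int_pow_closed subsetD)
    finally have "\<exists>a\<in>B. m [^] (n * q) \<otimes> inv (a [^] (n * q)) \<in> N" using pure n q by simp
    then obtain a where a: "a \<in> B" "m [^] (n * q) \<otimes> inv (a [^] (n * q)) \<in> N" by blast
    have [simp]: "a \<in> carrier G" using a B by (meson subgroup.mem_carrier)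
    have "(inv a \<otimes> m) [^] (n * q) \<in> N" using a by (simp add: int_pow_distrib int_pow_inv m_comm)
    then have "inv a \<otimes> m \<in> T" using mult_pos_pos[OF n q] by (auto simp: T_def)
    moreover have "m = a \<otimes> (inv a \<otimes> m)" by (simp add: m_assoc[symmetric])
    ultimately show "m \<in> B <#> T" using a set_mult_memI by metis
  qed
qed

text \<open>The invariants survive unions of chains because each involves only finitely many
  elements of \<open>K\<close> at a time; \<open>complement_step\<close> contradicts maximality as
  long as \<open>B <#> K\<close> is proper.\<close>

lemma complement_exists:
  assumes N: "subgroup N G" and B: "subgroup B G" and NB: "N \<subseteq> B"
    and tf: "\<forall>b\<in>B. \<forall>n::int. n > 0 \<longrightarrow> b [^] n \<in> N \<longrightarrow> b \<in> N"
    and pure: "\<And>g n::int. g \<in> carrier G \<Longrightarrow> n > 0 \<Longrightarrow> g [^] n \<in> B \<Longrightarrow> \<exists>b\<in>B. g [^] n \<otimes> inv (b [^] n) \<in> N"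
    and complete: "chain_complete G N B"
  shows "\<exists>K. subgroup K G \<and> K \<inter> B = N \<and> B <#> K = carrier G"
proof -
  define \<K> where "\<K> = {K. subgroup K G \<and> N \<subseteq> K \<and> K \<inter> B \<subseteq> N \<and> isolated G (B <#> K)}"
  let ?T = "{m \<in> carrier G. \<exists>n>0. m [^] (n::int) \<in> N}"
  have "?T \<in> \<K>"
  proof -
    have "N \<subseteq> ?T"
      using subgroup.mem_carrier[OF N] by (auto intro!: exI[of _ "1::int"])
    moreover have "?T \<inter> B \<subseteq> N" using tf by blast
    ultimately show ?thesis using torsion_isolated[OF N B NB pure] unfolding \<K>_def by blast
  qed
  moreover have "\<Union>\<C> \<in> \<K>" if "\<C> \<noteq> {}" and chain: "subset.chain \<K> \<C>" for \<C>
  proof -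
    have \<C>: "subgroup K G" "N \<subseteq> K" "K \<inter> B \<subseteq> N" "isolated G (B <#> K)" if "K \<in> \<C>" for K
      using chain that by (auto simp: subset.chain_def \<K>_def)
    obtain K0 where K0: "K0 \<in> \<C>" using \<open>\<C> \<noteq> {}\<close> by auto
    have "subgroup (\<Union>\<C>) G"
    proof
      show "\<Union>\<C> \<subseteq> carrier G" using \<C>(1) by (auto dest: subgroup.mem_carrier)
      show "\<one> \<in> \<Union>\<C>" using \<C>(1) K0 by (auto intro: subgroup.one_closed)
      show "inv x \<in> \<Union>\<C>" if "x \<in> \<Union>\<C>" for x
        using that \<C>(1) by (auto intro: subgroup.m_inv_closed)
      show "x \<otimes> y \<in> \<Union>\<C>" if xy: "x \<in> \<Union>\<C>" "y \<in> \<Union>\<C>" for x y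
      proof -
        obtain K1 K2 where K: "K1 \<in> \<C>" "K2 \<in> \<C>" "x \<in> K1" "y \<in> K2" using xy by auto
        then have "K1 \<subseteq> K2 \<or> K2 \<subseteq> K1" using chain by (auto simp: subset.chain_def)
        then show ?thesis using K \<C>(1) by (meson UnionI subgroup.m_closed subsetD)
      qed
    qed
    moreover have "isolated G (B <#> \<Union>\<C>)"
      using \<C>(4) by (fastforce simp: isolated_def set_mult_def)
    moreover have "N \<subseteq> \<Union>\<C>" using \<C>(2) K0 by blast
    moreover have "\<Union>\<C> \<inter> B \<subseteq> N" using \<C>(3) by blast
    ultimately show ?thesis by (simp add: \<K>_def)
  qed
  ultimately obtain K where "K \<in> \<K>" and max: "\<And>X. X \<in> \<K> \<Longrightarrow> K \<subseteq> X \<Longrightarrow> X = K"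
    using subset_Zorn_nonempty[of \<K>] by blast
  then have K: "subgroup K G" "N \<subseteq> K" "K \<inter> B \<subseteq> N" "isolated G (B <#> K)" by (auto simp: \<K>_def)
  have "g \<in> B <#> K" if "g \<in> carrier G" for g
  proof (rule ccontr)
    assume "g \<notin> B <#> K"
    from complement_step[OF K(1) N B K(2-4) tf complete that this] obtain K'
      where K': "subgroup K' G" "K \<subset> K'" "K' \<inter> B \<subseteq> N" "isolated G (B <#> K')" by blast
    then have "K' \<in> \<K>" using K(2) by (auto simp: \<K>_def)
    then show False using max K'(2) by blast
  qed
  then have "B <#> K = carrier G"
    using subgroup.subset[OF mult_subgroups[OF B K(1)]] by blast
  moreover have "K \<inter> B = N" using K(2,3) NB by blast
  ultimately show ?thesis using K(1) by blast
qed

end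

section \<open>Cyclic orders and cosets of a c-convex subgroup\<close>

text \<open>A power of \<open>c\<close> with positive exponent lies on the same side of the identity
  as \<open>c\<close>, at least as far out.\<close>

lemma total_group_order_torsion_free:
  assumes r: "total_group_order K r" and c: "c \<in> carrier K" and n: "c [^]\<^bsub>K\<^esub> Suc n = \<one>\<^bsub>K\<^esub>"
  shows "c = \<one>\<^bsub>K\<^esub>"
proof -
  interpret group K using r by (simp add: total_group_order_def)
  have mono: "(u \<otimes>\<^bsub>K\<^esub> x, u \<otimes>\<^bsub>K\<^esub> y) \<in> r"
    if "(x, y) \<in> r" "x \<in> carrier K" "y \<in> carrier K" "u \<in> carrier K" for x y u
  proof -
    have "(u \<otimes>\<^bsub>K\<^esub> x \<otimes>\<^bsub>K\<^esub> \<one>\<^bsub>K\<^esub>, u \<otimes>\<^bsub>K\<^esub> y \<otimes>\<^bsub>K\<^esub> \<one>\<^bsub>K\<^esub>) \<in> r"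
      using r that one_closed unfolding total_group_order_def by blast
    then show ?thesis using that by simp
  qed
  have lin: "linear_order_on (carrier K) r" using r by (simp add: total_group_order_def)
  then have rfl: "\<And>x. x \<in> carrier K \<Longrightarrow> (x, x) \<in> r" and tr: "trans r" and as: "antisym r"
    and tot: "\<And>x y. x \<in> carrier K \<Longrightarrow> y \<in> carrier K \<Longrightarrow> x \<noteq> y \<Longrightarrow> (x, y) \<in> r \<or> (y, x) \<in> r"
    by (auto simp: order_on_defs total_on_def refl_on_def)
  show ?thesis
  proof (cases "(\<one>\<^bsub>K\<^esub>, c) \<in> r")
    case True
    have "(c, c [^]\<^bsub>K\<^esub> Suc n) \<in> r"
    proof (induction n)
      case (Suc n)
      have "(c [^]\<^bsub>K\<^esub> Suc n, c [^]\<^bsub>K\<^esub> Suc (Suc n)) \<in> r" using mono[OF True, of "c [^]\<^bsub>K\<^esub> Suc n"] c by simp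
      then show ?case using Suc tr by (meson transD)
    qed (use rfl c in simp)
    then show ?thesis using True n as by (simp add: antisym_def)
  next
    case False
    then have neg: "(c, \<one>\<^bsub>K\<^esub>) \<in> r" using tot[of c "\<one>\<^bsub>K\<^esub>"] c rfl by auto
    have "(c [^]\<^bsub>K\<^esub> Suc n, c) \<in> r"
    proof (induction n)
      case (Suc n)
      have "(c [^]\<^bsub>K\<^esub> Suc (Suc n), c [^]\<^bsub>K\<^esub> Suc n) \<in> r" using mono[OF neg, of "c [^]\<^bsub>K\<^esub> Suc n"] c by simp
      then show ?case using Suc tr by (meson transD)
    qed (use rfl c in simp)
    then show ?thesis using False n by simp
  qed
qed

text \<open>Linearity provides only some total order \<open>r\<close>; it is recovered from
  \<open>R\<close>. With \<open>d\<close> the quotient of \<open>b\<close> by \<open>a\<close>, the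
  relation of \<open>a\<close> to \<open>b\<close> is that of the identity to \<open>d\<close>, and
  also that of \<open>d\<close> to its square. Each of the three ways in which \<open>R\<close> can
  hold for identity, \<open>d\<close> and square contains one of these two comparisons.\<close>

lemma linear_cyclic_order_induced:
  assumes "linear_cyclic_order K R" and xyz: "x \<in> carrier K" "y \<in> carrier K" "z \<in> carrier K"
  defines "s \<equiv> induced_order K R"
  shows "R x y z \<longleftrightarrow> ((x, y) \<in> s - Id \<and> (y, z) \<in> s - Id) \<or>
                    ((y, z) \<in> s - Id \<and> (z, x) \<in> s - Id) \<or>
                    ((z, x) \<in> s - Id \<and> (x, y) \<in> s - Id)"
proof -
  obtain r where r: "total_group_order K r" and
    "\<forall>x\<in>carrier K. \<forall>y\<in>carrier K. \<forall>z\<in>carrier K.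
        R x y z \<longleftrightarrow> ((x, y) \<in> r - Id \<and> (y, z) \<in> r - Id) \<or>
                    ((y, z) \<in> r - Id \<and> (z, x) \<in> r - Id) \<or>
                    ((z, x) \<in> r - Id \<and> (x, y) \<in> r - Id)"
    using assms(1) unfolding linear_cyclic_order_def by (elim exE conjE)
  note R = this(2)[rule_format]
  interpret group K using r by (simp add: total_group_order_def)
  have mono: "(x \<otimes>\<^bsub>K\<^esub> v, y \<otimes>\<^bsub>K\<^esub> v) \<in> r"
    if "(x, y) \<in> r" "x \<in> carrier K" "y \<in> carrier K" "v \<in> carrier K" for x y v
  proof -
    have "(\<one>\<^bsub>K\<^esub> \<otimes>\<^bsub>K\<^esub> x \<otimes>\<^bsub>K\<^esub> v, \<one>\<^bsub>K\<^esub> \<otimes>\<^bsub>K\<^esub> y \<otimes>\<^bsub>K\<^esub> v) \<in> r"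
      using r that one_closed unfolding total_group_order_def by blast
    then show ?thesis using that by simp
  qed
  have lin: "linear_order_on (carrier K) r" using r by (simp add: total_group_order_def)
  then have tr: "trans r" and as: "antisym r" by (auto simp: order_on_defs)
  have s: "(a, b) \<in> s - Id \<longleftrightarrow> (a, b) \<in> r - Id" if ab [simp]: "a \<in> carrier K" "b \<in> carrier K" for a b
  proof (cases "a = b")
    case False
    define d where "d = b \<otimes>\<^bsub>K\<^esub> inv\<^bsub>K\<^esub> a"
    have d [simp]: "d \<in> carrier K" by (simp add: d_def)
    have da: "b = d \<otimes>\<^bsub>K\<^esub> a" by (simp add: d_def m_assoc)
    have d1: "d \<noteq> \<one>\<^bsub>K\<^esub>" using False da by auto
    then have dd: "d \<noteq> d \<otimes>\<^bsub>K\<^esub> d" by (metis d l_cancel_one)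
    have pos: "(\<one>\<^bsub>K\<^esub>, d) \<in> r \<longleftrightarrow> (a, b) \<in> r"
      using mono[of "\<one>\<^bsub>K\<^esub>" d a] mono[of a b "inv\<^bsub>K\<^esub> a"] by (auto simp: da m_assoc)
    have pos2: "(\<one>\<^bsub>K\<^esub>, d) \<in> r \<longleftrightarrow> (d, d \<otimes>\<^bsub>K\<^esub> d) \<in> r"
      using mono[of "\<one>\<^bsub>K\<^esub>" d d] mono[of d "d \<otimes>\<^bsub>K\<^esub> d" "inv\<^bsub>K\<^esub> d"] by (auto simp: m_assoc)
    have "R \<one>\<^bsub>K\<^esub> d (d \<otimes>\<^bsub>K\<^esub> d) \<longleftrightarrow> (\<one>\<^bsub>K\<^esub>, d) \<in> r"
    proof
      assume "(\<one>\<^bsub>K\<^esub>, d) \<in> r"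
      then show "R \<one>\<^bsub>K\<^esub> d (d \<otimes>\<^bsub>K\<^esub> d)" using pos2 d1 dd by (subst R) auto
    next
      assume "R \<one>\<^bsub>K\<^esub> d (d \<otimes>\<^bsub>K\<^esub> d)"
      then show "(\<one>\<^bsub>K\<^esub>, d) \<in> r" using pos2 by (subst (asm) R) auto
    qed
    then show ?thesis using False pos by (simp add: s_def induced_order_def d_def numeral_2_eq_2)
  qed simp
  show ?thesis unfolding R[OF xyz] s[OF xyz(1,2)] s[OF xyz(2,3)] s[OF xyz(3,1)] ..
qed

text \<open>Both cases of \<open>c_convex\<close> are covered: for \<open>C = carrier G\<close> the
  clause \<open>convex\<close> holds trivially.\<close>

locale c_convex_subgroup = comm_group G + cyclically_ordered_group G R for G (structure) and R +
  fixes C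
  assumes subC: "subgroup C G"
    and linear: "linear_cyclic_order (G\<lparr>carrier := C\<rparr>) R"
    and convex: "h \<in> C \<Longrightarrow> g \<in> carrier G \<Longrightarrow> R (inv h) \<one> h \<Longrightarrow> R \<one> g h \<Longrightarrow> g \<in> C"
begin

lemma C_carrier [simp]: "c \<in> C \<Longrightarrow> c \<in> carrier G"
  by (rule subgroup.mem_carrier[OF subC])

lemma one_in_C [simp]: "\<one> \<in> C"
  by (rule subgroup.one_closed[OF subC])

lemmas C_closed [simp] = subgroup.m_closed[OF subC] subgroup.m_inv_closed[OF subC]

lemma torsion_free:
  assumes "c \<in> C" "n > 0" "c [^] (n::int) = \<one>"
  shows "c = \<one>"
proof -
  obtain m where m: "n = int (Suc m)" using assms(2) by (metis gr0_implies_Suc zero_less_imp_eq_int)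
  obtain r where "total_group_order (G\<lparr>carrier := C\<rparr>) r"
    using linear by (auto simp: linear_cyclic_order_def)
  then show ?thesis
    using total_group_order_torsion_free[of "G\<lparr>carrier := C\<rparr>" r c m] assms
    by (simp add: m int_pow_int nat_pow_consistent[symmetric] del: of_nat_Suc nat_pow_Suc)
qed

lemma no_involution: "c \<in> C \<Longrightarrow> c \<otimes> c = \<one> \<Longrightarrow> c = \<one>"
  using torsion_free[of c 2] by (simp add: int_pow_def numeral_2_eq_2)

section \<open>Calculation rules for a translation invariant cyclic order\<close>

lemma translate:
  assumes "x \<in> carrier G" "y \<in> carrier G" "z \<in> carrier G" "u \<in> carrier G"
  shows "R (x \<otimes> u) (y \<otimes> u) (z \<otimes> u) \<longleftrightarrow> R x y z"
proof
  assume "R x y z"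
  then show "R (x \<otimes> u) (y \<otimes> u) (z \<otimes> u)" using translation[of x y z \<one> u] assms by simp
next
  assume "R (x \<otimes> u) (y \<otimes> u) (z \<otimes> u)"
  then show "R x y z" using translation[of "x \<otimes> u" "y \<otimes> u" "z \<otimes> u" \<one> "inv u"] assms by (simp add: m_assoc)
qed

lemma rotate:
  assumes "x \<in> carrier G" "y \<in> carrier G" "z \<in> carrier G"
  shows "R x y z \<longleftrightarrow> R y z x"
  using cyclic[of x y z] cyclic[of y z x] cyclic[of z x y] assms by blast

lemma swap:
  assumes "x \<in> carrier G" "y \<in> carrier G" "z \<in> carrier G" "x \<noteq> y" "y \<noteq> z" "x \<noteq> z"
  shows "R x z y \<longleftrightarrow> \<not> R x y z"
proof
  assume "R x z y"
  then show "\<not> R x y z"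
    using assms rotate[of x z y] rotate[of z y x] transitive[of x y z x] strict[of x x z] by blast
qed (use total[of x y z] assms in blast)

lemma C_mult_mem: "c \<in> C \<Longrightarrow> w \<in> carrier G \<Longrightarrow> w \<otimes> c \<in> C \<longleftrightarrow> w \<in> C"
proof
  assume c: "c \<in> C" "w \<in> carrier G" and "w \<otimes> c \<in> C"
  then have "w \<otimes> c \<otimes> inv c \<in> C" by simp
  then show "w \<in> C" using c by (simp add: m_assoc)
qed simp

section \<open>Signs of elements of \<open>C\<close> and their position relative to other
  cosets\<close>

lemma positive_cases:
  assumes "c \<in> C" "c \<noteq> \<one>"
  shows "R (inv c) \<one> c \<longleftrightarrow> \<not> R c \<one> (inv c)"
proof -
  have "inv c \<noteq> c" using no_involution[of c] assms by (metis C_carrier r_inv)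
  moreover have "\<one> \<noteq> inv c" using assms by (metis C_carrier inv_eq_1_iff)
  ultimately have "R \<one> c (inv c) \<longleftrightarrow> \<not> R \<one> (inv c) c" using swap[of \<one> "inv c" c] assms by auto
  then show ?thesis
    using rotate[of "inv c" \<one> c] rotate[of c \<one> "inv c"] assms by simp
qed

text \<open>An outside element cannot separate the identity from a positive \<open>c\<close>:
  \<open>R \<one> w c\<close> would put \<open>w\<close> into \<open>C\<close> by convexity. For
  negative \<open>c\<close> the same argument applies to \<open>inv c\<close> and
  \<open>w \<otimes> inv c\<close>, and is translated back by \<open>c\<close>.\<close>

lemma positive_iff:
  assumes c: "c \<in> C" "c \<noteq> \<one>" and w: "w \<in> carrier G" "w \<notin> C"
  shows "R \<one> c w \<longleftrightarrow> R (inv c) \<one> c"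
proof -
  have pos: "R \<one> d v" if d: "d \<in> C" "d \<noteq> \<one>" "R (inv d) \<one> d" and v: "v \<in> carrier G" "v \<notin> C" for d v
  proof (rule ccontr)
    assume "\<not> R \<one> d v"
    moreover have "v \<noteq> \<one>" "v \<noteq> d" using v(2) d(1) one_in_C by blast+
    ultimately have "R \<one> v d" using total[of \<one> d v] d v one_in_C by auto
    then show False using convex[of d v] d v by blast
  qed
  have "\<not> R \<one> c w" if "\<not> R (inv c) \<one> c"
  proof
    assume R: "R \<one> c w"
    have c': "inv c \<in> C" "inv c \<noteq> \<one>" using c by (auto simp: inv_eq_1_iff)
    have "R c \<one> (inv c)" using that positive_cases c by blast
    then have "R \<one> (inv c) (w \<otimes> inv c)"
      using pos[OF c', of "w \<otimes> inv c"] c w by (simp add: C_mult_mem)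
    then have "R c \<one> w" using translate[of \<one> "inv c" "w \<otimes> inv c" c] c w by (simp add: m_assoc)
    then have "R \<one> w c" using rotate[of c \<one> w] c w by simp
    moreover have "\<one> \<noteq> w" "c \<noteq> w" using c w by auto
    ultimately show False using R swap[of \<one> c w] c w by auto
  qed
  then show ?thesis using pos c w by blast
qed

text \<open>By \<open>positive_iff\<close> a positive \<open>c\<close> lies between the identity and
  \<open>v\<close>, a negative one between \<open>u\<close> and the identity; transitivity does the
  rest.\<close>

lemma replace_one:
  assumes c: "c \<in> C" and u: "u \<in> carrier G" "u \<notin> C" and v: "v \<in> carrier G" "v \<notin> C" and R: "R u \<one> v"
  shows "R u c v"
proof (cases "c = \<one>")
  case False
  have cu: "c \<noteq> u" "\<one> \<noteq> u" using u c one_in_C by auto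
  show ?thesis
  proof (cases "R (inv c) \<one> c")
    case True
    then have "R \<one> c v" using positive_iff c False v by simp
    then show ?thesis using transitive[of u \<one> v c] R u v c by simp
  next
    case nonpos: False
    then have "\<not> R \<one> c u" using positive_iff c False u by simp
    then have "R c \<one> u" using swap[of \<one> c u] rotate[of c \<one> u] rotate[of \<one> u c] c cu False u by auto
    moreover have "R \<one> v u" using R rotate[of u \<one> v] u v by simp
    ultimately have "R c v u" using transitive[of c \<one> u v] u v c by simp
    then show ?thesis using rotate[of c v u] rotate[of v u c] u v c by simp
  qed
qed (use R in simp)

abbreviation lt where "lt a b \<equiv> (a, b) \<in> induced_order (G\<lparr>carrier := C\<rparr>) R - Id"

lemma lt_iff:
  assumes "a \<in> C" "b \<in> C"
  shows "lt a b \<longleftrightarrow> a \<noteq> b \<and> R (inv (b \<otimes> inv a)) \<one> (b \<otimes> inv a)"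
proof -
  let ?d = "b \<otimes> inv a"
  have "R (inv ?d) \<one> ?d \<longleftrightarrow> R \<one> ?d (?d \<otimes> ?d)"
    using translate[of "inv ?d" \<one> ?d ?d] assms by simp
  then show ?thesis
    using assms m_inv_consistent[OF subC] by (auto simp: induced_order_def numeral_2_eq_2 nat_pow_def)
qed

section \<open>Reading the cyclic order off cosets and differences\<close>

lemma coset_eq_iff:
  assumes "x \<in> carrier G" "y \<in> carrier G"
  shows "C #> x = C #> y \<longleftrightarrow> x \<otimes> inv y \<in> C"
proof -
  have "x \<otimes> inv y \<in> C \<longleftrightarrow> x \<in> C #> y"
    using subgroup.rcos_module[OF subC is_group assms(2,1)] by blast
  moreover have "x \<in> C #> y \<longleftrightarrow> C #> x = C #> y"
    using repr_independence[OF _ assms(2) subC, of x] rcos_self[OF assms(1) subC] by blast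
  ultimately show ?thesis by blast
qed

text \<open>After division by \<open>x\<close> the claim compares the sign of
  \<open>y \<otimes> inv x\<close> with its place relative to \<open>z \<otimes> inv x\<close>,
  which is outside \<open>C\<close>; this is \<open>positive_iff\<close>.\<close>

lemma coset_pair_iff:
  assumes "x \<in> carrier G" "y \<in> carrier G" "z \<in> carrier G" "a \<in> C" "b \<in> C"
    and "C #> x = C #> y" "C #> y \<noteq> C #> z" and ab: "a \<otimes> inv b = x \<otimes> inv y"
  shows "R x y z \<longleftrightarrow> lt a b"
proof -
  have "inv (a \<otimes> inv b) = inv (x \<otimes> inv y)" using ab by simp
  then have d: "b \<otimes> inv a = y \<otimes> inv x" using assms(1-5) by (simp add: inv_mult_group)
  have dC: "y \<otimes> inv x \<in> C" using assms coset_eq_iff[of y x] by simp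
  have zC: "z \<otimes> inv x \<notin> C" using assms coset_eq_iff[of z x] by simp
  have R: "R x y z \<longleftrightarrow> R \<one> (y \<otimes> inv x) (z \<otimes> inv x)"
    using translate[of x y z "inv x"] assms by simp
  have eq: "a = b \<longleftrightarrow> y \<otimes> inv x = \<one>"
    using assms d by (metis C_carrier inv_closed inv_equality inv_inv r_inv)
  show ?thesis
  proof (cases "a = b")
    case True
    then show ?thesis using R eq strict[of \<one> \<one> "z \<otimes> inv x"] assms by auto
  next
    case False
    then show ?thesis using R eq positive_iff[OF dC, of "z \<otimes> inv x"] zC lt_iff[of a b] assms d by simp
  qed
qed

lemma replace_middle:
  assumes "x \<in> carrier G" "y \<in> carrier G" "z \<in> carrier G" "y' \<in> carrier G"
    and "C #> x \<noteq> C #> y" "C #> y \<noteq> C #> z" "C #> y' = C #> y" and R: "R x y z"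
  shows "R x y' z"
proof -
  have "R (x \<otimes> inv y) \<one> (z \<otimes> inv y)" using R translate[of x y z "inv y"] assms by simp
  then have "R (x \<otimes> inv y) (y' \<otimes> inv y) (z \<otimes> inv y)"
    using replace_one[of "y' \<otimes> inv y" "x \<otimes> inv y" "z \<otimes> inv y"] assms coset_eq_iff[of x y]
      coset_eq_iff[of z y] coset_eq_iff[of y' y] by simp
  then show ?thesis using translate[of x y' z "inv y"] assms by simp
qed

text \<open>\<open>replace_middle\<close> exchanges one representative at a time, and rotation
  brings each of the three into the middle.\<close>

lemma quotient_iff:
  assumes [simp]: "x \<in> carrier G" "y \<in> carrier G" "z \<in> carrier G"
    and distinct: "C #> x \<noteq> C #> y" "C #> y \<noteq> C #> z" "C #> x \<noteq> C #> z"
  shows "quotient_cyclic_order R (C #> x) (C #> y) (C #> z) \<longleftrightarrow> R x y z"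
proof
  assume "R x y z"
  then show "quotient_cyclic_order R (C #> x) (C #> y) (C #> z)"
    using distinct rcos_self[OF _ subC] unfolding quotient_cyclic_order_def by (meson assms(1-3))
next
  assume "quotient_cyclic_order R (C #> x) (C #> y) (C #> z)"
  then obtain x' y' z' where x': "x' \<in> C #> x" and y': "y' \<in> C #> y" and z': "z' \<in> C #> z" and R: "R x' y' z'"
    unfolding quotient_cyclic_order_def by blast
  have [simp]: "x' \<in> carrier G" "y' \<in> carrier G" "z' \<in> carrier G"
    using x' y' z' subgroup.elemrcos_carrier[OF subC is_group] assms(1-3) by blast+
  have e: "C #> x' = C #> x" "C #> y' = C #> y" "C #> z' = C #> z"
    using x' y' z' repr_independence[OF _ _ subC] by auto
  have "R x' y z'" by (rule replace_middle[OF _ _ _ _ _ _ _ R]) (use distinct e in simp_all)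
  then have "R y z' x'" using rotate[of x' y z'] by simp
  then have "R y z x'" by (rule replace_middle[rotated 7]) (use distinct e in simp_all)
  then have "R z x' y" using rotate[of y z x'] by simp
  then have "R z x y" by (rule replace_middle[rotated 7]) (use distinct e in simp_all)
  then show "R x y z" using rotate[of z x y] by simp
qed

text \<open>\<open>a\<close>, \<open>b\<close>, \<open>c\<close> stand for the values of a
  projection onto \<open>C\<close>, which preserves differences within a coset because these lie in
  \<open>C\<close>. The possible coincidences among the three cosets match the five disjuncts of
  \<open>lex_cyclic_order\<close>.\<close>

lemma lex_iff:
  assumes x [simp]: "x \<in> carrier G" "y \<in> carrier G" "z \<in> carrier G" and C [simp]: "a \<in> C" "b \<in> C" "c \<in> C"
    and xy: "C #> x = C #> y \<Longrightarrow> a \<otimes> inv b = x \<otimes> inv y"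
    and yz: "C #> y = C #> z \<Longrightarrow> b \<otimes> inv c = y \<otimes> inv z"
    and zx: "C #> z = C #> x \<Longrightarrow> c \<otimes> inv a = z \<otimes> inv x"
  shows "R x y z \<longleftrightarrow> lex_cyclic_order (quotient_cyclic_order R) (induced_order (G\<lparr>carrier := C\<rparr>) R)
     (C #> x, a) (C #> y, b) (C #> z, c)"
proof -
  consider (dist) "C #> x \<noteq> C #> y" "C #> y \<noteq> C #> z" "C #> x \<noteq> C #> z"
    | (xy) "C #> x = C #> y" "C #> y \<noteq> C #> z"
    | (yz) "C #> y = C #> z" "C #> z \<noteq> C #> x"
    | (zx) "C #> z = C #> x" "C #> x \<noteq> C #> y"
    | (eq) "C #> x = C #> y" "C #> y = C #> z" by metis
  then show ?thesis
  proof cases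
    case dist
    then show ?thesis using quotient_iff[of x y z] by (simp add: lex_cyclic_order_def)
  next
    case xy
    then have "R x y z \<longleftrightarrow> lt a b" using coset_pair_iff[of x y z a b] assms(7) by simp
    then show ?thesis using xy by (simp add: lex_cyclic_order_def quotient_cyclic_order_def)
  next
    case yz
    then have "R x y z \<longleftrightarrow> lt b c" using coset_pair_iff[of y z x b c] assms(8) rotate[of x y z] by simp
    then show ?thesis using yz by (auto simp add: lex_cyclic_order_def quotient_cyclic_order_def)
  next
    case zx
    then have "R x y z \<longleftrightarrow> lt c a" using coset_pair_iff[of z x y c a] assms(9) rotate[of z x y] by simp
    then show ?thesis using zx by (auto simp add: lex_cyclic_order_def quotient_cyclic_order_def)
  next
    case eq
    have 1: "a \<otimes> inv b = x \<otimes> inv y" "c \<otimes> inv a = z \<otimes> inv x" using eq xy zx by auto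
    \<comment> \<open>A single translation carries \<open>x\<close>, \<open>y\<close>,
      \<open>z\<close> to \<open>a\<close>, \<open>b\<close>, \<open>c\<close> inside
      \<open>C\<close>, where linearity applies.\<close>
    let ?t = "inv x \<otimes> a"
    have xa: "x \<otimes> ?t = a" by (simp add: m_assoc[symmetric])
    have "inv (a \<otimes> inv b) = inv (x \<otimes> inv y)" using 1 by simp
    then have "b \<otimes> inv a = y \<otimes> inv x" by (simp add: inv_mult_group)
    then have "(y \<otimes> inv x) \<otimes> a = (b \<otimes> inv a) \<otimes> a" by simp
    then have yb: "y \<otimes> ?t = b" by (simp add: m_assoc)
    have "(z \<otimes> inv x) \<otimes> a = (c \<otimes> inv a) \<otimes> a" using 1 by simp
    then have zc: "z \<otimes> ?t = c" by (simp add: m_assoc)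
    have "R (x \<otimes> ?t) (y \<otimes> ?t) (z \<otimes> ?t) \<longleftrightarrow> R x y z" by (rule translate) simp_all
    then have abc: "R x y z \<longleftrightarrow> R a b c" unfolding xa yb zc by simp
    have "R a b c \<longleftrightarrow> (lt a b \<and> lt b c) \<or> (lt b c \<and> lt c a) \<or> (lt c a \<and> lt a b)"
      by (rule linear_cyclic_order_induced[OF linear]) simp_all
    then show ?thesis unfolding abc using eq by (simp add: lex_cyclic_order_def quotient_cyclic_order_def)
  qed
qed

end

section \<open>Isomorphism of ultrapowers\<close>

text \<open>Finer filters are smaller, so Zorn's lemma is applied to the reversed order. Lying below
  \<open>sequentially\<close> makes the filter nonprincipal.\<close>

lemma nonprincipal_ultrafilter_exists:
  "\<exists>U :: nat filter. U \<noteq> bot \<and> U \<le> sequentially \<and>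
     (\<forall>P. (\<forall>\<^sub>F i in U. P i) \<or> (\<forall>\<^sub>F i in U. \<not> P i))"
proof -
  define A where "A = {F :: nat filter. F \<noteq> bot \<and> F \<le> sequentially}"
  have "\<exists>U\<in>A. \<forall>F\<in>A. F \<le> U \<longrightarrow> F = U"
  proof (rule predicate_Zorn)
    show "partial_order_on A (relation_of (\<lambda>F G. G \<le> F) A)"
      by (rule partial_order_on_relation_ofI) auto
  next
    fix C assume C: "C \<in> Chains (relation_of (\<lambda>F G. G \<le> F) A)"
    then have CA: "F \<in> A" if "F \<in> C" for F using that by (auto simp: Chains_def relation_of_def)
    show "\<exists>F\<in>A. \<forall>G\<in>C. F \<le> G"
    proof (cases "C = {}")
      case True
      then show ?thesis by (auto simp: A_def intro!: exI[of _ sequentially])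
    next
      case False
      \<comment> \<open>A chain is directed, so what holds eventually for its infimum does so for a
        single member; hence the infimum stays proper.\<close>
      have "\<exists>F\<in>C. F \<le> inf G H" if "G \<in> C" "H \<in> C" for G H
        using C that by (fastforce simp: Chains_def relation_of_def)
      then have "eventually P (Inf C) \<longleftrightarrow> (\<exists>F\<in>C. eventually P F)" for P
        by (rule eventually_Inf_base[OF False])
      then have "Inf C \<noteq> bot" using CA by (auto simp: trivial_limit_def A_def)
      moreover have "Inf C \<le> sequentially" using False CA by (auto simp: A_def intro: Inf_lower2)
      ultimately show ?thesis by (auto simp: A_def intro: Inf_lower)
    qed
  qed
  then obtain U where U: "U \<noteq> bot" "U \<le> sequentially"
    and max: "\<And>F. F \<noteq> bot \<Longrightarrow> F \<le> U \<Longrightarrow> F = U"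
    by (auto simp: A_def)
  \<comment> \<open>Restricting \<open>U\<close> to the indices with \<open>P\<close> yields the
    improper filter or, by minimality, \<open>U\<close> again.\<close>
  have "(\<forall>\<^sub>F i in U. P i) \<or> (\<forall>\<^sub>F i in U. \<not> P i)" for P
  proof (cases "inf U (principal {i. P i}) = bot")
    case True
    then show ?thesis by (auto simp: trivial_limit_def eventually_inf_principal)
  next
    case False
    then have eq: "inf U (principal {i. P i}) = U" by (rule max) simp
    have "\<forall>\<^sub>F i in inf U (principal {i. P i}). P i" by (simp add: eventually_inf_principal)
    then show ?thesis unfolding eq ..
  qed
  then show ?thesis using U by blast
qed

text \<open>The default \<open>a0\<close> keeps the values of \<open>f\<close> in \<open>A\<close>
  at every index, as representatives of ultrapower elements require.\<close>

lemma eventually_choice: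
  assumes "\<forall>\<^sub>F i in U. \<exists>a\<in>A. Q i a" and "A \<noteq> {}"
  shows "\<exists>f. (\<forall>i. f i \<in> A) \<and> (\<forall>\<^sub>F i in U. Q i (f i))"
proof -
  obtain a0 where a0: "a0 \<in> A" using assms(2) by blast
  define f where "f i = (if \<exists>a\<in>A. Q i a then SOME a. a \<in> A \<and> Q i a else a0)" for i
  have f: "f i \<in> A \<and> Q i (f i)" if "\<exists>a\<in>A. Q i a" for i
    using someI_ex[of "\<lambda>a. a \<in> A \<and> Q i a"] that unfolding f_def by auto
  have "\<forall>\<^sub>F i in U. Q i (f i)"
    by (rule eventually_mono[OF assms(1)]) (use f in blast)
  moreover have "f i \<in> A" for i
    using f[of i] a0 by (cases "\<exists>a\<in>A. Q i a") (simp_all add: f_def)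
  ultimately show ?thesis by blast
qed

section \<open>Dependence of satisfaction on the free variables\<close>

lemma term_val_cong: "(\<And>v. v \<in> term_vars t \<Longrightarrow> e v = e' v) \<Longrightarrow> term_val G e t = term_val G e' t"
  by (induction t) auto

lemma sat_cong: "(\<And>v. v \<in> free_vars \<phi> \<Longrightarrow> e v = e' v) \<Longrightarrow> sat G R e \<phi> = sat G R e' \<phi>"
proof (induction \<phi> arbitrary: e e')
  case (Equal s t)
  then show ?case using term_val_cong[of s e e' G] term_val_cong[of t e e' G] by simp
next
  case (Cyc s t u)
  then show ?case
    using term_val_cong[of s e e' G] term_val_cong[of t e e' G] term_val_cong[of u e e' G] by simp
next
  case (Exists j \<phi>)
  have "sat G R (e(j := a)) \<phi> = sat G R (e'(j := a)) \<phi>" for a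
    using Exists.prems by (intro Exists.IH) auto
  then show ?case by simp
next
  case (Neg \<phi>)
  then show ?case by (metis free_vars.simps(3) sat.simps(3))
next
  case (Conj \<phi> \<psi>)
  then show ?case by (metis UnCI free_vars.simps(4) sat.simps(4))
qed

lemma models_sentence:
  assumes "sentence \<phi>" "a \<in> carrier G"
  shows "models G R \<phi> \<longleftrightarrow> sat G R (\<lambda>_. a) \<phi>"
proof -
  have "sat G R e \<phi> = sat G R (\<lambda>_. a) \<phi>" for e
    using assms(1) by (intro sat_cong) (simp add: sentence_def)
  then show ?thesis using assms(2) by (auto simp: models_def)
qed

text \<open>The relation \<open>T\<close> plays the role of an isomorphism between the ultrapowers of the two
  structures; it relates representatives, so that no quotients are formed.\<close>

locale ultrapower_isomorphism =
  fixes G :: "('a, 'b) monoid_scheme" and R :: "'a \<Rightarrow> 'a \<Rightarrow> 'a \<Rightarrow> bool"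
    and H :: "('c, 'd) monoid_scheme" and S :: "'c \<Rightarrow> 'c \<Rightarrow> 'c \<Rightarrow> bool"
    and U :: "'i filter" and T :: "('i \<Rightarrow> 'a) \<Rightarrow> ('i \<Rightarrow> 'c) \<Rightarrow> bool"
  assumes nonempty: "U \<noteq> bot"
    and ultra: "(\<forall>\<^sub>F i in U. P i) \<or> (\<forall>\<^sub>F i in U. \<not> P i)"
    and T_carrier: "T f d \<Longrightarrow> f i \<in> carrier G" "T f d \<Longrightarrow> d i \<in> carrier H"
    and T_one: "T (\<lambda>_. \<one>\<^bsub>G\<^esub>) (\<lambda>_. \<one>\<^bsub>H\<^esub>)"
    and T_mult: "\<lbrakk>T f d; T f' d'\<rbrakk> \<Longrightarrow> T (\<lambda>i. f i \<otimes>\<^bsub>G\<^esub> f' i) (\<lambda>i. d i \<otimes>\<^bsub>H\<^esub> d' i)"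
    and T_inv: "T f d \<Longrightarrow> T (\<lambda>i. inv\<^bsub>G\<^esub> (f i)) (\<lambda>i. inv\<^bsub>H\<^esub> (d i))"
    and T_eq: "\<lbrakk>T f d; T f' d'\<rbrakk> \<Longrightarrow> (\<forall>\<^sub>F i in U. f i = f' i) \<longleftrightarrow> (\<forall>\<^sub>F i in U. d i = d' i)"
    and T_R: "\<lbrakk>T f d; T f' d'; T f'' d''\<rbrakk> \<Longrightarrow>
      (\<forall>\<^sub>F i in U. R (f i) (f' i) (f'' i)) \<longleftrightarrow> (\<forall>\<^sub>F i in U. S (d i) (d' i) (d'' i))"
    and T_forth: "(\<And>i. f i \<in> carrier G) \<Longrightarrow> \<exists>d. T f d"
    and T_back: "(\<And>i. d i \<in> carrier H) \<Longrightarrow> \<exists>f. T f d"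
begin

lemma not_iff: "(\<forall>\<^sub>F i in U. \<not> P i) \<longleftrightarrow> \<not> (\<forall>\<^sub>F i in U. P i)"
proof
  assume "\<forall>\<^sub>F i in U. \<not> P i"
  then show "\<not> (\<forall>\<^sub>F i in U. P i)"
    using nonempty by (simp add: not_eventually eventually_frequently)
qed (use ultra[of P] in blast)

lemma T_term:
  assumes "\<And>v. T (\<lambda>i. e i v) (\<lambda>i. e' i v)"
  shows "T (\<lambda>i. term_val G (e i) t) (\<lambda>i. term_val H (e' i) t)"
proof (induction t)
  case (Plus s t)
  then show ?case using T_mult by simp
next
  case (Minus t)
  then show ?case using T_inv by simp
qed (simp_all add: assms T_one)

text \<open>The theorem of Los for both structures at once: negation uses that \<open>U\<close> is
  ultra, and for a quantifier a witness chosen in almost all coordinates is carried across by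
  \<open>T_forth\<close> or \<open>T_back\<close>.\<close>

lemma T_sat:
  assumes "\<And>v. T (\<lambda>i. e i v) (\<lambda>i. e' i v)"
  shows "(\<forall>\<^sub>F i in U. sat G R (e i) \<phi>) \<longleftrightarrow> (\<forall>\<^sub>F i in U. sat H S (e' i) \<phi>)"
  using assms
proof (induction \<phi> arbitrary: e e')
  case (Equal s t)
  show ?case using T_eq[OF T_term T_term, OF Equal Equal] by simp
next
  case (Cyc s t u)
  show ?case using T_R[OF T_term T_term T_term, OF Cyc Cyc Cyc] by simp
next
  case (Neg \<phi>)
  show ?case using Neg.IH[OF Neg.prems] by (simp add: not_iff)
next
  case (Conj \<phi> \<psi>)
  show ?case using Conj.IH(1)[OF Conj.prems] Conj.IH(2)[OF Conj.prems] by (simp add: eventually_conj_iff)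
next
  case (Exists j \<phi>)
  have upd: "(\<forall>\<^sub>F i in U. sat G R ((e i)(j := f i)) \<phi>) \<longleftrightarrow> (\<forall>\<^sub>F i in U. sat H S ((e' i)(j := d i)) \<phi>)"
    if "T f d" for f d
  proof (rule Exists.IH)
    show "T (\<lambda>i. ((e i)(j := f i)) v) (\<lambda>i. ((e' i)(j := d i)) v)" for v
      using Exists.prems that by (cases "v = j") auto
  qed
  show ?case
  proof
    assume "\<forall>\<^sub>F i in U. sat G R (e i) (Exists j \<phi>)"
    then have "\<forall>\<^sub>F i in U. \<exists>a\<in>carrier G. sat G R ((e i)(j := a)) \<phi>" by simp
    from eventually_choice[OF this] T_carrier(1)[OF T_one]
    obtain f where f: "\<And>i. f i \<in> carrier G" "\<forall>\<^sub>F i in U. sat G R ((e i)(j := f i)) \<phi>"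
      by blast
    obtain d where d: "T f d" using T_forth[of f] f(1) by blast
    have "\<forall>\<^sub>F i in U. sat H S ((e' i)(j := d i)) \<phi>" using f(2) upd[OF d] by simp
    then show "\<forall>\<^sub>F i in U. sat H S (e' i) (Exists j \<phi>)"
      by (rule eventually_mono) (use T_carrier(2)[OF d] in auto)
  next
    assume "\<forall>\<^sub>F i in U. sat H S (e' i) (Exists j \<phi>)"
    then have "\<forall>\<^sub>F i in U. \<exists>a\<in>carrier H. sat H S ((e' i)(j := a)) \<phi>" by simp
    from eventually_choice[OF this] T_carrier(2)[OF T_one]
    obtain d where d: "\<And>i. d i \<in> carrier H" "\<forall>\<^sub>F i in U. sat H S ((e' i)(j := d i)) \<phi>"
      by blast
    obtain f where f: "T f d" using T_back[of d] d(1) by blast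
    have "\<forall>\<^sub>F i in U. sat G R ((e i)(j := f i)) \<phi>" using d(2) upd[OF f] by simp
    then show "\<forall>\<^sub>F i in U. sat G R (e i) (Exists j \<phi>)"
      by (rule eventually_mono) (use T_carrier(1)[OF f] in auto)
  qed
qed

text \<open>Along constant assignments satisfaction does not depend on the index, and for a proper
  filter holding almost everywhere is then plain truth.\<close>

theorem elementarily_equivalent: "elementarily_equivalent G R H S"
  unfolding elementarily_equivalent_def
proof (intro allI impI)
  fix \<phi> assume "sentence \<phi>"
  then show "models G R \<phi> \<longleftrightarrow> models H S \<phi>"
    using T_sat[of "\<lambda>_ _. \<one>\<^bsub>G\<^esub>" "\<lambda>_ _. \<one>\<^bsub>H\<^esub>" \<phi>] T_one T_carrier[OF T_one] nonempty
      models_sentence[of \<phi> "\<one>\<^bsub>G\<^esub>" G R] models_sentence[of \<phi> "\<one>\<^bsub>H\<^esub>" H S]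
    by simp
qed

end

section \<open>Splitting of the ultrapower\<close>

locale pure_c_convex_subgroup = c_convex_subgroup +
  fixes U :: "nat filter"
  assumes pure: "pure_in G C"
    and nonempty: "U \<noteq> bot" and nonprincipal: "U \<le> sequentially"
    and ultra: "(\<forall>\<^sub>F i in U. P i) \<or> (\<forall>\<^sub>F i in U. \<not> P i)"
begin

lemma C_nonempty: "C \<noteq> {}"
  using one_in_C by blast

section \<open>The countable power of \<open>G\<close> modulo the ultrafilter\<close>

abbreviation \<Pi>G where "\<Pi>G \<equiv> product_group (UNIV :: nat set) (\<lambda>_. G)"

lemma carrier_\<Pi>G: "f \<in> carrier \<Pi>G \<longleftrightarrow> (\<forall>i. f i \<in> carrier G)"
  by (auto simp: PiE_iff)

lemma mult_\<Pi>G: "f \<otimes>\<^bsub>\<Pi>G\<^esub> g = (\<lambda>i. f i \<otimes> g i)"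
  by (simp add: restrict_def)

lemma inv_\<Pi>G: "f \<in> carrier \<Pi>G \<Longrightarrow> inv\<^bsub>\<Pi>G\<^esub> f = (\<lambda>i. inv (f i))"
  by (simp add: restrict_def)

lemma comm_group_\<Pi>G: "comm_group \<Pi>G"
  by (rule group.group_comm_groupI) (auto simp: PiE_iff m_comm)

lemma int_pow_\<Pi>G:
  assumes "f \<in> carrier \<Pi>G"
  shows "f [^]\<^bsub>\<Pi>G\<^esub> (n::int) = (\<lambda>i. f i [^] n)"
proof
  fix i
  have "(\<lambda>f. f i) \<in> hom \<Pi>G G" by (auto simp: hom_def)
  then show "(f [^]\<^bsub>\<Pi>G\<^esub> n) i = f i [^] n"
    using hom_int_pow[of "\<lambda>f. f i" \<Pi>G G f n] comm_group_\<Pi>G assms by (simp add: comm_group_def)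
qed

text \<open>For a subgroup \<open>S\<close> these represent its ultrapower;
  \<open>ev_in {\<one>}\<close> is the kernel of the map from the product onto the ultrapower of
  \<open>G\<close>.\<close>

definition ev_in where "ev_in S = {f \<in> carrier \<Pi>G. \<forall>\<^sub>F i in U. f i \<in> S}"

lemma ev_in_iff: "f \<in> ev_in S \<longleftrightarrow> (\<forall>i. f i \<in> carrier G) \<and> (\<forall>\<^sub>F i in U. f i \<in> S)"
  by (simp only: ev_in_def carrier_\<Pi>G mem_Collect_eq)

lemma subgroup_ev_in:
  assumes S: "subgroup S G"
  shows "subgroup (ev_in S) \<Pi>G"
proof
  show "ev_in S \<subseteq> carrier \<Pi>G" unfolding ev_in_def by blast
  show "\<one>\<^bsub>\<Pi>G\<^esub> \<in> ev_in S" by (simp add: ev_in_iff subgroup.one_closed[OF S])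
next
  fix f g assume f: "f \<in> ev_in S" and g: "g \<in> ev_in S"
  then have "\<forall>\<^sub>F i in U. f i \<in> S" "\<forall>\<^sub>F i in U. g i \<in> S" by (simp_all add: ev_in_iff)
  then have "\<forall>\<^sub>F i in U. f i \<otimes> g i \<in> S"
    by eventually_elim (rule subgroup.m_closed[OF S])
  then show "f \<otimes>\<^bsub>\<Pi>G\<^esub> g \<in> ev_in S"
    using f g unfolding mult_\<Pi>G by (simp add: ev_in_iff)
next
  fix f assume f: "f \<in> ev_in S"
  then have "\<forall>\<^sub>F i in U. f i \<in> S" by (simp add: ev_in_iff)
  then have "\<forall>\<^sub>F i in U. inv (f i) \<in> S"
    by eventually_elim (rule subgroup.m_inv_closed[OF S])
  moreover have "f \<in> carrier \<Pi>G" using f unfolding ev_in_def by blast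
  ultimately show "inv\<^bsub>\<Pi>G\<^esub> f \<in> ev_in S"
    using f inv_\<Pi>G by (simp only: ev_in_iff inv_closed simp_thms)
qed

text \<open>Multiplying the two relations cancels \<open>y\<close>; since the second exponent is a
  multiple of the first, both powers combine into one \<open>l\<close>-th power.\<close>

lemma chain_step:
  assumes C: "c \<in> C" "d \<in> C" and x: "x \<in> carrier G" "y \<in> carrier G" "z \<in> carrier G"
    and 1: "y \<otimes> inv x \<otimes> c [^] (l::int) = \<one>" and 2: "z \<otimes> inv y \<otimes> d [^] (l * q) = \<one>"
  shows "z \<otimes> inv x \<otimes> (d [^] q \<otimes> c) [^] l = \<one>"
proof -
  have "z \<otimes> inv x \<otimes> (d [^] q \<otimes> c) [^] l = z \<otimes> inv x \<otimes> (d [^] (l * q) \<otimes> c [^] l)"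
    using C by (simp add: int_pow_distrib int_pow_pow mult.commute)
  also have "\<dots> = (inv y \<otimes> y) \<otimes> (z \<otimes> inv x \<otimes> (d [^] (l * q) \<otimes> c [^] l))"
    using C x by simp
  also have "\<dots> = (z \<otimes> inv y \<otimes> d [^] (l * q)) \<otimes> (y \<otimes> inv x \<otimes> c [^] l)"
    using C x by (simp only: m_ac m_closed inv_closed int_pow_closed C_carrier)
  finally show ?thesis by (simp add: 1 2)
qed

text \<open>Countable saturation of the ultrapower: the \<open>i\<close>-th coordinate of the limit is taken from the last
  \<open>x k\<close> with \<open>k \<le> i\<close> up to which the congruences hold in the \<open>i\<close>-th coordinate.\<close>

lemma chain_complete_ev_in: "chain_complete \<Pi>G (ev_in {\<one>}) (ev_in C)"
  unfolding chain_complete_def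
proof (intro allI impI)
  fix x :: "nat \<Rightarrow> nat \<Rightarrow> 'a" and L :: "nat \<Rightarrow> int"
  assume x: "\<forall>n. x n \<in> ev_in C" and L: "\<forall>n. 0 < L n \<and> L n dvd L (Suc n)"
    and cauchy: "\<forall>n. \<exists>b\<in>ev_in C. x (Suc n) \<otimes>\<^bsub>\<Pi>G\<^esub> inv\<^bsub>\<Pi>G\<^esub> (x n) \<otimes>\<^bsub>\<Pi>G\<^esub> b [^]\<^bsub>\<Pi>G\<^esub> L n \<in> ev_in {\<one>}"
  have car: "f \<in> carrier \<Pi>G" if "f \<in> ev_in S" for f S using that by (simp add: ev_in_def)
  have xG [simp]: "x n i \<in> carrier G" for n i using x by (simp add: ev_in_iff)
  define Q where "Q n i \<longleftrightarrow> x n i \<in> C \<and> x (Suc n) i \<in> C \<and>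
      (\<exists>c\<in>C. x (Suc n) i \<otimes> inv (x n i) \<otimes> c [^] L n = \<one>)" for n i
  have Ldvd: "L n dvd L m" if "n \<le> m" for n m
    using that by (induction m rule: dec_induct) (use L in \<open>auto intro: dvd_trans\<close>)
  have xC: "\<forall>\<^sub>F i in U. x n i \<in> C" for n using x by (simp add: ev_in_iff)
  have Q: "\<forall>\<^sub>F i in U. Q n i" for n
  proof -
    obtain b where b: "b \<in> ev_in C" "x (Suc n) \<otimes>\<^bsub>\<Pi>G\<^esub> inv\<^bsub>\<Pi>G\<^esub> (x n) \<otimes>\<^bsub>\<Pi>G\<^esub> b [^]\<^bsub>\<Pi>G\<^esub> L n \<in> ev_in {\<one>}"
      using cauchy by blast
    have "\<forall>\<^sub>F i in U. x (Suc n) i \<otimes> inv (x n i) \<otimes> b i [^] L n = \<one>"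
      using b(2) unfolding mult_\<Pi>G inv_\<Pi>G[OF car[OF x[rule_format]]] int_pow_\<Pi>G[OF car[OF b(1)]] ev_in_iff
      by simp
    moreover have "\<forall>\<^sub>F i in U. b i \<in> C" using b(1) by (simp add: ev_in_iff)
    ultimately show ?thesis using xC[of n] xC[of "Suc n"]
      by eventually_elim (auto simp: Q_def)
  qed
  \<comment> \<open>The bound by \<open>i\<close> makes a greatest value exist, and nonprincipality
    lets that bound exceed any given \<open>n\<close> almost everywhere.\<close>
  define k where "k i = (GREATEST k. k \<le> i \<and> (\<forall>l<k. Q l i))" for i
  have kQ: "Q l i" if "l < k i" for l i
    using GreatestI_nat[of "\<lambda>k. k \<le> i \<and> (\<forall>l<k. Q l i)" 0 i] that by (auto simp: k_def)
  have k_ge: "\<forall>\<^sub>F i in U. n \<le> k i" for n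
  proof -
    have "\<forall>\<^sub>F i in U. n \<le> i"
      using nonprincipal eventually_ge_at_top[of n] by (rule filter_leD)
    moreover have "\<forall>\<^sub>F i in U. \<forall>l\<in>{..<n}. Q l i"
      using Q by (intro eventually_ball_finite) auto
    ultimately show ?thesis
    proof eventually_elim
      case (elim i)
      then show ?case
        using Greatest_le_nat[of "\<lambda>k. k \<le> i \<and> (\<forall>l<k. Q l i)" n i] by (auto simp: k_def)
    qed
  qed
  define y where "y i = x (k i) i" for i
  have yG [simp]: "y i \<in> carrier G" for i by (simp add: y_def)
  \<comment> \<open>One valid link is needed: the link \<open>k i - 1\<close> ends in
    \<open>x (k i) i\<close> and records its membership in \<open>C\<close>.\<close>
  have "\<forall>\<^sub>F i in U. y i \<in> C"
    using k_ge[of 1]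
  proof eventually_elim
    case (elim i)
    then show ?case using kQ[of "k i - 1" i] by (simp add: Q_def y_def)
  qed
  then have yC: "y \<in> ev_in C" by (simp add: ev_in_iff)
  have "\<exists>b\<in>ev_in C. y \<otimes>\<^bsub>\<Pi>G\<^esub> inv\<^bsub>\<Pi>G\<^esub> (x n) \<otimes>\<^bsub>\<Pi>G\<^esub> b [^]\<^bsub>\<Pi>G\<^esub> L n \<in> ev_in {\<one>}" for n
  proof -
    \<comment> \<open>The links from \<open>n\<close> up to \<open>k i\<close> telescope within
      coordinate \<open>i\<close>, as all later moduli are multiples of \<open>L n\<close>.\<close>
    have chain: "\<exists>c\<in>C. x m i \<otimes> inv (x n i) \<otimes> c [^] L n = \<one>" if "n \<le> m" "m \<le> k i" for m i
      using that
    proof (induction m rule: dec_induct)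
      case base
      then show ?case by (auto intro!: bexI[of _ \<one>])
    next
      case (step m)
      obtain c where c: "c \<in> C" "x m i \<otimes> inv (x n i) \<otimes> c [^] L n = \<one>" using step by auto
      obtain d where d: "d \<in> C" "x (Suc m) i \<otimes> inv (x m i) \<otimes> d [^] L m = \<one>"
        using kQ[of m i] step by (auto simp: Q_def)
      obtain q where q: "L m = L n * q" using Ldvd[OF step(1)] by (auto simp: dvd_def)
      have "x (Suc m) i \<otimes> inv (x n i) \<otimes> (d [^] q \<otimes> c) [^] L n = \<one>"
        by (rule chain_step[OF c(1) d(1) _ _ _ c(2)]) (use d(2) q in simp_all)
      moreover have "d [^] q \<otimes> c \<in> C" using c d subgroup_int_pow_closed[OF subC] by simp
      ultimately show ?case by blast
    qed
    have "\<forall>\<^sub>F i in U. \<exists>c\<in>C. y i \<otimes> inv (x n i) \<otimes> c [^] L n = \<one>"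
      using k_ge[of n] by eventually_elim (use chain in \<open>simp add: y_def\<close>)
    from eventually_choice[OF this C_nonempty]
    obtain b where b: "\<And>i. b i \<in> C" "\<forall>\<^sub>F i in U. y i \<otimes> inv (x n i) \<otimes> b i [^] L n = \<one>" by blast
    have bC: "b \<in> ev_in C" using b(1) by (simp add: ev_in_iff)
    have "(\<lambda>i. y i \<otimes> inv (x n i) \<otimes> b i [^] L n) \<in> ev_in {\<one>}"
      using b by (simp add: ev_in_iff)
    then show ?thesis
      unfolding mult_\<Pi>G inv_\<Pi>G[OF car[OF x[rule_format]]] by (intro bexI[OF _ bC]) (simp only: int_pow_\<Pi>G[OF car[OF bC]])
  qed
  then show "\<exists>y\<in>ev_in C. \<forall>n. \<exists>b\<in>ev_in C. y \<otimes>\<^bsub>\<Pi>G\<^esub> inv\<^bsub>\<Pi>G\<^esub> (x n) \<otimes>\<^bsub>\<Pi>G\<^esub> b [^]\<^bsub>\<Pi>G\<^esub> L n \<in> ev_in {\<one>}"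
    using yC by blast
qed

text \<open>Torsion-freeness and purity are inherited from \<open>C\<close> coordinate by
  coordinate; completeness is what the ultrapower adds.\<close>

lemma complement_ev_in:
  obtains K where "subgroup K \<Pi>G" "K \<inter> ev_in C = ev_in {\<one>}" "ev_in C <#>\<^bsub>\<Pi>G\<^esub> K = carrier \<Pi>G"
proof -
  have car: "f \<in> carrier \<Pi>G" if "f \<in> ev_in S" for f S using that by (simp add: ev_in_def)
  have "\<exists>K. subgroup K \<Pi>G \<and> K \<inter> ev_in C = ev_in {\<one>} \<and> ev_in C <#>\<^bsub>\<Pi>G\<^esub> K = carrier \<Pi>G"
  proof (rule comm_group.complement_exists[OF comm_group_\<Pi>G])
    show "subgroup (ev_in {\<one>}) \<Pi>G" "subgroup (ev_in C) \<Pi>G"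
      using subgroup_ev_in triv_subgroup subC by blast+
    show "ev_in {\<one>} \<subseteq> ev_in C"
      by (auto simp: ev_in_iff elim!: eventually_mono)
    show "chain_complete \<Pi>G (ev_in {\<one>}) (ev_in C)" by (rule chain_complete_ev_in)
    show "\<forall>b\<in>ev_in C. \<forall>n::int. n > 0 \<longrightarrow> b [^]\<^bsub>\<Pi>G\<^esub> n \<in> ev_in {\<one>} \<longrightarrow> b \<in> ev_in {\<one>}"
    proof (intro ballI allI impI)
      fix b and n :: int
      assume b: "b \<in> ev_in C" and n: "n > 0" and bn: "b [^]\<^bsub>\<Pi>G\<^esub> n \<in> ev_in {\<one>}"
      have "\<forall>\<^sub>F i in U. b i [^] n = \<one>"
        using bn unfolding int_pow_\<Pi>G[OF car[OF b]] by (simp add: ev_in_iff)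
      moreover have "\<forall>\<^sub>F i in U. b i \<in> C" using b by (simp add: ev_in_iff)
      ultimately have "\<forall>\<^sub>F i in U. b i = \<one>" by eventually_elim (use torsion_free n in blast)
      then show "b \<in> ev_in {\<one>}" using b by (simp add: ev_in_iff)
    qed
    fix g and n :: int
    assume g: "g \<in> carrier \<Pi>G" and n: "n > 0" and gn: "g [^]\<^bsub>\<Pi>G\<^esub> n \<in> ev_in C"
    have gG [simp]: "g i \<in> carrier G" for i using g unfolding carrier_\<Pi>G by blast
    have "\<forall>\<^sub>F i in U. g i [^] n \<in> C"
      using gn unfolding int_pow_\<Pi>G[OF g] by (simp add: ev_in_iff)
    then have "\<forall>\<^sub>F i in U. \<exists>c\<in>C. c [^] n = g i [^] n"
    proof eventually_elim
      case (elim i)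
      obtain m where "n = int m" using n by (metis zero_less_imp_eq_int)
      then show ?case using pure elim gG[of i] unfolding pure_in_def by (metis int_pow_int)
    qed
    from eventually_choice[OF this C_nonempty]
    obtain b where b: "\<And>i. b i \<in> C" "\<forall>\<^sub>F i in U. b i [^] n = g i [^] n" by blast
    have bC: "b \<in> ev_in C" using b by (simp add: ev_in_iff)
    have "b [^]\<^bsub>\<Pi>G\<^esub> n \<in> carrier \<Pi>G"
      unfolding int_pow_\<Pi>G[OF car[OF bC]] carrier_\<Pi>G using b(1) by simp
    moreover have "\<forall>\<^sub>F i in U. g i [^] n \<otimes> inv (b i [^] n) = \<one>"
      using b(2) by eventually_elim simp
    ultimately have "g [^]\<^bsub>\<Pi>G\<^esub> n \<otimes>\<^bsub>\<Pi>G\<^esub> inv\<^bsub>\<Pi>G\<^esub> (b [^]\<^bsub>\<Pi>G\<^esub> n) \<in> ev_in {\<one>}"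
      unfolding mult_\<Pi>G using b(1) by (simp only: inv_\<Pi>G int_pow_\<Pi>G[OF g] int_pow_\<Pi>G[OF car[OF bC]]) (simp add: ev_in_iff)
    then show "\<exists>b\<in>ev_in C. g [^]\<^bsub>\<Pi>G\<^esub> n \<otimes>\<^bsub>\<Pi>G\<^esub> inv\<^bsub>\<Pi>G\<^esub> (b [^]\<^bsub>\<Pi>G\<^esub> n) \<in> ev_in {\<one>}" using bC by blast
  qed
  then show thesis using that by blast
qed

section \<open>Group operations of the lexicographic product\<close>

abbreviation D where "D \<equiv> (G Mod C) \<times>\<times> (G\<lparr>carrier := C\<rparr>)"

lemma normal_C: "C \<lhd> G"
  using subC by (rule subgroup_imp_normal)

lemma coset_in_FactGroup: "x \<in> carrier G \<Longrightarrow> C #> x \<in> carrier (G Mod C)"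
  by (simp add: carrier_FactGroup)

lemma D_mult:
  assumes "x \<in> carrier G" "y \<in> carrier G"
  shows "(C #> x, a) \<otimes>\<^bsub>D\<^esub> (C #> y, b) = (C #> (x \<otimes> y), a \<otimes> b)"
  using assms normal.rcos_sum[OF normal_C] by simp

lemma D_inv:
  assumes "x \<in> carrier G" "a \<in> C"
  shows "inv\<^bsub>D\<^esub> (C #> x, a) = (C #> inv x, inv a)"
  using assms normal.rcos_inv[OF normal_C] normal.inv_FactGroup[OF normal_C]
    normal.factorgroup_is_group[OF normal_C] subgroup.subgroup_is_group[OF subC is_group]
    m_inv_consistent[OF subC] coset_in_FactGroup
  by (simp add: inv_DirProd)

lemma D_group: "group D"
  by (intro DirProd_group normal.factorgroup_is_group[OF normal_C] subgroup.subgroup_is_group[OF subC is_group])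

section \<open>The isomorphism determined by a complement\<close>

context
  fixes K
  assumes K: "subgroup K \<Pi>G" and K_Int: "K \<inter> ev_in C = ev_in {\<one>}"
    and K_mult: "ev_in C <#>\<^bsub>\<Pi>G\<^esub> K = carrier \<Pi>G"
begin

text \<open>Modulo the filter, \<open>b\<close> is the projection of \<open>f\<close> onto \<open>ev_in C\<close> along \<open>K\<close>.\<close>

definition proj_rel where
  "proj_rel f b \<longleftrightarrow> (\<forall>i. f i \<in> carrier G) \<and> b \<in> ev_in C \<and> (\<lambda>i. f i \<otimes> inv (b i)) \<in> K"

lemma proj_relD:
  assumes "proj_rel f b"
  shows "f i \<in> carrier G" "b i \<in> carrier G" "\<forall>\<^sub>F i in U. b i \<in> C"
  using assms by (simp_all add: proj_rel_def ev_in_iff)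

lemma K_closed:
  shows "f \<in> K \<Longrightarrow> g \<in> K \<Longrightarrow> (\<lambda>i. f i \<otimes> g i) \<in> K" and "f \<in> K \<Longrightarrow> (\<lambda>i. inv (f i)) \<in> K"
  using subgroup.m_closed[OF K, of f g] subgroup.m_inv_closed[OF K, of f] subgroup.mem_carrier[OF K, of f]
  by (simp_all only: mult_\<Pi>G inv_\<Pi>G)

lemma proj_rel_mult:
  assumes f: "proj_rel f b" and g: "proj_rel g c"
  shows "proj_rel (\<lambda>i. f i \<otimes> g i) (\<lambda>i. b i \<otimes> c i)"
proof -
  note [simp] = proj_relD(1,2)[OF f] proj_relD(1,2)[OF g]
  have "(\<lambda>i. b i \<otimes> c i) \<in> ev_in C"
    using proj_relD(3)[OF f] proj_relD(3)[OF g] unfolding ev_in_iff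
    by (auto elim: eventually_elim2)
  moreover have "(\<lambda>i. (f i \<otimes> inv (b i)) \<otimes> (g i \<otimes> inv (c i))) \<in> K"
    using K_closed(1) f g by (simp add: proj_rel_def)
  moreover have "(\<lambda>i. (f i \<otimes> inv (b i)) \<otimes> (g i \<otimes> inv (c i))) = (\<lambda>i. f i \<otimes> g i \<otimes> inv (b i \<otimes> c i))"
    by (simp add: inv_mult m_ac)
  ultimately show ?thesis by (simp add: proj_rel_def)
qed

lemma proj_rel_inv:
  assumes f: "proj_rel f b"
  shows "proj_rel (\<lambda>i. inv (f i)) (\<lambda>i. inv (b i))"
proof -
  note [simp] = proj_relD(1,2)[OF f]
  have "(\<lambda>i. inv (b i)) \<in> ev_in C"
    using proj_relD(3)[OF f] unfolding ev_in_iff by (auto elim: eventually_mono)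
  moreover have "(\<lambda>i. inv (f i \<otimes> inv (b i))) \<in> K"
    using K_closed(2) f by (simp add: proj_rel_def)
  then have "(\<lambda>i. inv (f i) \<otimes> inv (inv (b i))) \<in> K"
    by (simp add: inv_mult)
  ultimately show ?thesis using f by (simp add: proj_rel_def)
qed

lemma proj_rel_self:
  assumes "\<And>i. b i \<in> carrier G" "\<forall>\<^sub>F i in U. b i \<in> C"
  shows "proj_rel b b"
  using assms subgroup.one_closed[OF K] by (simp add: proj_rel_def ev_in_iff restrict_def)

text \<open>The quotient of \<open>f\<close> by \<open>b\<close> lies both in \<open>K\<close> and
  in \<open>ev_in C\<close>, so it is trivial modulo the ultrafilter.\<close>

lemma proj_rel_unique:
  assumes f: "proj_rel f b" and fC: "\<forall>\<^sub>F i in U. f i \<in> C"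
  shows "\<forall>\<^sub>F i in U. f i = b i"
proof -
  note [simp] = proj_relD(1,2)[OF f]
  have "\<forall>\<^sub>F i in U. f i \<otimes> inv (b i) \<in> C"
    using fC proj_relD(3)[OF f] by eventually_elim simp
  then have "(\<lambda>i. f i \<otimes> inv (b i)) \<in> K \<inter> ev_in C" using f by (simp add: proj_rel_def ev_in_iff)
  then have "\<forall>\<^sub>F i in U. f i \<otimes> inv (b i) = \<one>" unfolding K_Int by (simp add: ev_in_iff)
  then show ?thesis
  proof eventually_elim
    case (elim i)
    then have "f i \<otimes> inv (b i) \<otimes> b i = \<one> \<otimes> b i" by simp
    then show ?case by (simp add: m_assoc)
  qed
qed

text \<open>The implication stands under the quantifier over indices because \<open>lex_iff\<close>
  asks for it in each coordinate. By \<open>ultra\<close> the cosets agree almost everywhere or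
  differ almost everywhere; if they agree, the difference is almost everywhere in \<open>C\<close>
  and is its own projection.\<close>

lemma proj_rel_diff:
  assumes f: "proj_rel f b" and g: "proj_rel g c"
  shows "\<forall>\<^sub>F i in U. C #> f i = C #> g i \<longrightarrow> b i \<otimes> inv (c i) = f i \<otimes> inv (g i)"
proof -
  note [simp] = proj_relD(1,2)[OF f] proj_relD(1,2)[OF g]
  consider "\<forall>\<^sub>F i in U. C #> f i = C #> g i" | "\<forall>\<^sub>F i in U. C #> f i \<noteq> C #> g i" using ultra by blast
  then show ?thesis
  proof cases
    case 1
    then have "\<forall>\<^sub>F i in U. f i \<otimes> inv (g i) \<in> C" by (simp add: coset_eq_iff)
    then have "\<forall>\<^sub>F i in U. f i \<otimes> inv (g i) = b i \<otimes> inv (c i)"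
      by (rule proj_rel_unique[OF proj_rel_mult[OF f proj_rel_inv[OF g]]])
    then show ?thesis by eventually_elim simp
  next
    case 2
    then show ?thesis by eventually_elim simp
  qed
qed

lemma proj_rel_exists:
  assumes "\<And>i. f i \<in> carrier G"
  shows "\<exists>b. (\<forall>i. b i \<in> C) \<and> proj_rel f b"
proof -
  have "f \<in> ev_in C <#>\<^bsub>\<Pi>G\<^esub> K" using assms unfolding K_mult carrier_\<Pi>G by blast
  then obtain b k where b: "b \<in> ev_in C" and k: "k \<in> K" and f: "f = (\<lambda>i. b i \<otimes> k i)"
    unfolding set_mult_def mult_\<Pi>G by blast
  have kG [simp]: "k i \<in> carrier G" for i using subgroup.mem_carrier[OF K k] carrier_\<Pi>G by blast
  have bG [simp]: "b i \<in> carrier G" for i using b by (simp add: ev_in_iff)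
  \<comment> \<open>Changing \<open>b\<close> outside a large set of indices costs an element of
    \<open>ev_in {\<one>}\<close>, which \<open>K\<close> contains, and gives values in
    \<open>C\<close> at every index.\<close>
  define c where "c i = (if b i \<in> C then b i else \<one>)" for i
  have cG [simp]: "c i \<in> C" for i by (simp add: c_def)
  have bC: "\<forall>\<^sub>F i in U. b i \<in> C" using b by (simp add: ev_in_iff)
  have "\<forall>\<^sub>F i in U. b i \<otimes> inv (c i) = \<one>"
    using bC by eventually_elim (simp add: c_def)
  then have "(\<lambda>i. b i \<otimes> inv (c i)) \<in> K \<inter> ev_in C" unfolding K_Int by (simp add: ev_in_iff)
  then have "(\<lambda>i. (b i \<otimes> inv (c i)) \<otimes> k i) \<in> K" using K_closed(1)[OF _ k] by blast
  moreover have "(\<lambda>i. (b i \<otimes> inv (c i)) \<otimes> k i) = (\<lambda>i. f i \<otimes> inv (c i))"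
    by (simp add: f m_ac)
  ultimately have "proj_rel f c" using assms by (simp add: proj_rel_def ev_in_iff)
  then show ?thesis using cG by blast
qed

text \<open>The pair is prescribed only almost everywhere: \<open>b\<close> takes values in
  \<open>C\<close> only there, whereas \<open>d\<close> must stay in \<open>carrier D\<close> at
  every index.\<close>

definition iso_rel where
  "iso_rel f d \<longleftrightarrow> (\<forall>i. d i \<in> carrier D) \<and>
     (\<exists>b. proj_rel f b \<and> (\<forall>\<^sub>F i in U. d i = (C #> f i, b i)))"

lemma iso_relE:
  assumes "iso_rel f d"
  obtains b where "proj_rel f b" "\<forall>\<^sub>F i in U. d i = (C #> f i, b i)" "\<forall>\<^sub>F i in U. b i \<in> C"
  using assms proj_relD(3) unfolding iso_rel_def by blast

lemma iso_rel_carrier: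
  assumes "iso_rel f d"
  shows "f i \<in> carrier G" "d i \<in> carrier D"
  using assms proj_relD(1) unfolding iso_rel_def by blast+

lemma iso_relI:
  assumes "proj_rel f b" "\<And>i. d i \<in> carrier D" "\<forall>\<^sub>F i in U. d i = (C #> f i, b i)"
  shows "iso_rel f d"
  using assms unfolding iso_rel_def by blast

lemma ultrapower_isomorphism:
  "ultrapower_isomorphism G R D (lex_cyclic_order (quotient_cyclic_order R) (induced_order (G\<lparr>carrier := C\<rparr>) R)) U iso_rel"
proof
  show "U \<noteq> bot" by (rule nonempty)
  show "(\<forall>\<^sub>F i in U. P i) \<or> (\<forall>\<^sub>F i in U. \<not> P i)" for P by (rule ultra)
  show "iso_rel f d \<Longrightarrow> f i \<in> carrier G" for f d i by (rule iso_rel_carrier(1))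
  show "iso_rel f d \<Longrightarrow> d i \<in> carrier D" for f d i by (rule iso_rel_carrier(2))
  have "C #> \<one> = C" by (rule coset_join2[OF _ subC]) simp_all
  then show "iso_rel (\<lambda>_. \<one>) (\<lambda>_. \<one>\<^bsub>D\<^esub>)"
    using group.is_monoid[OF D_group, THEN monoid.one_closed]
    by (intro iso_relI[OF proj_rel_self]) simp_all
  show "iso_rel (\<lambda>i. f i \<otimes> f' i) (\<lambda>i. d i \<otimes>\<^bsub>D\<^esub> d' i)" if f: "iso_rel f d" and f': "iso_rel f' d'" for f d f' d'
  proof -
    obtain b where b: "proj_rel f b" "\<forall>\<^sub>F i in U. d i = (C #> f i, b i)" "\<forall>\<^sub>F i in U. b i \<in> C" using f by (rule iso_relE)
    obtain b' where b': "proj_rel f' b'" "\<forall>\<^sub>F i in U. d' i = (C #> f' i, b' i)" "\<forall>\<^sub>F i in U. b' i \<in> C" using f' by (rule iso_relE)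
    have "\<forall>\<^sub>F i in U. d i \<otimes>\<^bsub>D\<^esub> d' i = (C #> (f i \<otimes> f' i), b i \<otimes> b' i)"
      using b(2) b'(2) by eventually_elim (simp only: D_mult iso_rel_carrier(1)[OF f] iso_rel_carrier(1)[OF f'])
    moreover have "d i \<otimes>\<^bsub>D\<^esub> d' i \<in> carrier D" for i
      by (rule monoid.m_closed[OF group.is_monoid[OF D_group] iso_rel_carrier(2)[OF f] iso_rel_carrier(2)[OF f']])
    ultimately show ?thesis by (intro iso_relI[OF proj_rel_mult[OF b(1) b'(1)]])
  qed
  show "iso_rel (\<lambda>i. inv (f i)) (\<lambda>i. inv\<^bsub>D\<^esub> (d i))" if f: "iso_rel f d" for f d
  proof -
    obtain b where b: "proj_rel f b" "\<forall>\<^sub>F i in U. d i = (C #> f i, b i)" "\<forall>\<^sub>F i in U. b i \<in> C" using f by (rule iso_relE)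
    have "\<forall>\<^sub>F i in U. inv\<^bsub>D\<^esub> (d i) = (C #> inv (f i), inv (b i))"
      using b(2,3) by eventually_elim (simp only: D_inv iso_rel_carrier(1)[OF f])
    moreover have "inv\<^bsub>D\<^esub> (d i) \<in> carrier D" for i
      by (rule group.inv_closed[OF D_group iso_rel_carrier(2)[OF f]])
    ultimately show ?thesis by (intro iso_relI[OF proj_rel_inv[OF b(1)]])
  qed
  show "(\<forall>\<^sub>F i in U. f i = f' i) \<longleftrightarrow> (\<forall>\<^sub>F i in U. d i = d' i)" if f: "iso_rel f d" and f': "iso_rel f' d'" for f d f' d'
  proof -
    obtain b where b: "proj_rel f b" "\<forall>\<^sub>F i in U. d i = (C #> f i, b i)" "\<forall>\<^sub>F i in U. b i \<in> C" using f by (rule iso_relE)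
    obtain b' where b': "proj_rel f' b'" "\<forall>\<^sub>F i in U. d' i = (C #> f' i, b' i)" "\<forall>\<^sub>F i in U. b' i \<in> C" using f' by (rule iso_relE)
    \<comment> \<open>Different cosets already separate \<open>d i\<close> from \<open>d' i\<close>;
      within one coset \<open>proj_rel_diff\<close> makes both differences vanish together.\<close>
    have "\<forall>\<^sub>F i in U. f i = f' i \<longleftrightarrow> d i = d' i"
      using b(2) b'(2) proj_rel_diff[OF b(1) b'(1)]
    proof eventually_elim
      case (elim i)
      note [simp] = iso_rel_carrier(1)[OF f] iso_rel_carrier(1)[OF f'] proj_relD(2)[OF b(1)] proj_relD(2)[OF b'(1)]
      have eq: "x = y \<longleftrightarrow> x \<otimes> inv y = \<one>" if "x \<in> carrier G" "y \<in> carrier G" for x y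
        using that by (metis inv_closed inv_equality inv_inv r_inv)
      have "b i = b' i \<longleftrightarrow> f i = f' i" if "C #> f i = C #> f' i"
        using that elim(3) eq[of "b i" "b' i"] eq[of "f i" "f' i"] by simp
      then show ?case using elim(1,2) by auto
    qed
    then show ?thesis by (rule eventually_subst)
  qed
  show "(\<forall>\<^sub>F i in U. R (f i) (f' i) (f'' i)) \<longleftrightarrow> (\<forall>\<^sub>F i in U. lex_cyclic_order (quotient_cyclic_order R) (induced_order (G\<lparr>carrier := C\<rparr>) R) (d i) (d' i) (d'' i))"
    if f: "iso_rel f d" and f': "iso_rel f' d'" and f'': "iso_rel f'' d''" for f d f' d' f'' d''
  proof -
    obtain b where b: "proj_rel f b" "\<forall>\<^sub>F i in U. d i = (C #> f i, b i)" "\<forall>\<^sub>F i in U. b i \<in> C" using f by (rule iso_relE)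
    obtain b' where b': "proj_rel f' b'" "\<forall>\<^sub>F i in U. d' i = (C #> f' i, b' i)" "\<forall>\<^sub>F i in U. b' i \<in> C" using f' by (rule iso_relE)
    obtain b'' where b'': "proj_rel f'' b''" "\<forall>\<^sub>F i in U. d'' i = (C #> f'' i, b'' i)" "\<forall>\<^sub>F i in U. b'' i \<in> C" using f'' by (rule iso_relE)
    have "\<forall>\<^sub>F i in U. R (f i) (f' i) (f'' i) \<longleftrightarrow>
        lex_cyclic_order (quotient_cyclic_order R) (induced_order (G\<lparr>carrier := C\<rparr>) R) (d i) (d' i) (d'' i)"
      using b(2,3) b'(2,3) b''(2,3) proj_rel_diff[OF b(1) b'(1)] proj_rel_diff[OF b'(1) b''(1)] proj_rel_diff[OF b''(1) b(1)]
    proof eventually_elim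
      case (elim i)
      show ?case unfolding elim(1,3,5)
        by (rule lex_iff) (use elim iso_rel_carrier(1)[OF f] iso_rel_carrier(1)[OF f'] iso_rel_carrier(1)[OF f''] in blast)+
    qed
    then show ?thesis by (rule eventually_subst)
  qed
  show "\<exists>d. iso_rel f d" if f: "\<And>i. f i \<in> carrier G" for f
  proof -
    obtain b where b: "\<And>i. b i \<in> C" "proj_rel f b" using proj_rel_exists[of f, OF f] by blast
    have "iso_rel f (\<lambda>i. (C #> f i, b i))"
      by (rule iso_relI[OF b(2)]) (simp_all add: coset_in_FactGroup f b(1))
    then show ?thesis by blast
  qed
  show "\<exists>f. iso_rel f d" if d: "\<And>i. d i \<in> carrier D" for d
  proof -
    have "\<exists>x\<in>carrier G. fst (d i) = C #> x" for i
      using d[of i] by (auto simp: carrier_FactGroup)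
    then obtain g where g [simp]: "\<And>i. g i \<in> carrier G" and dg: "\<And>i. fst (d i) = C #> g i" by metis
    have c [simp]: "snd (d i) \<in> C" for i using d[of i] by auto
    obtain b where b [simp]: "\<And>i. b i \<in> C" and gb: "proj_rel g b" using proj_rel_exists[of g, OF g] by blast
    \<comment> \<open>Exchanging the \<open>C\<close>-part \<open>b i\<close> of \<open>g i\<close>
      for the prescribed \<open>snd (d i)\<close> leaves the coset unchanged and makes
      \<open>snd (d i)\<close> the projection.\<close>
    define f where "f i = g i \<otimes> inv (b i) \<otimes> snd (d i)" for i
    have s: "proj_rel h h" if "\<And>i. h i \<in> C" for h using that by (intro proj_rel_self) simp_all
    have "proj_rel f (\<lambda>i. b i \<otimes> inv (b i) \<otimes> snd (d i))" unfolding f_def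
      by (rule proj_rel_mult[OF proj_rel_mult[OF gb proj_rel_inv[OF s]] s]) simp_all
    then have "proj_rel f (\<lambda>i. snd (d i))" by simp
    moreover have "C #> f i = C #> g i" for i
    proof -
      have "f i \<otimes> inv (g i) = (g i \<otimes> inv (g i)) \<otimes> (inv (b i) \<otimes> snd (d i))"
        unfolding f_def by (simp only: m_ac m_closed inv_closed g C_carrier b c)
      then show ?thesis by (subst coset_eq_iff) (simp_all add: f_def)
    qed
    then have di: "d i = (C #> f i, snd (d i))" for i using dg[of i] by (metis prod.collapse)
    have "\<forall>\<^sub>F i in U. d i = (C #> f i, snd (d i))"
      by (rule always_eventually) (use di in blast)
    ultimately have "iso_rel f d" by (intro iso_relI d)
    then show ?thesis by blast
  qed
qed

end

theorem elementarily_equivalent_lex: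
  "elementarily_equivalent G R D (lex_cyclic_order (quotient_cyclic_order R) (induced_order (G\<lparr>carrier := C\<rparr>) R))"
proof -
  obtain K where "subgroup K \<Pi>G" "K \<inter> ev_in C = ev_in {\<one>}" "ev_in C <#>\<^bsub>\<Pi>G\<^esub> K = carrier \<Pi>G"
    by (rule complement_ev_in)
  then show ?thesis
    by (rule ultrapower_isomorphism.elementarily_equivalent[OF ultrapower_isomorphism])
qed

end

theorem theorem6p1:
  fixes G :: "('a, 'b) monoid_scheme"
    and R :: "'a \<Rightarrow> 'a \<Rightarrow> 'a \<Rightarrow> bool"
    and C :: "'a set"
  assumes "comm_group G"
    and "cyclically_ordered_group G R"
    and "c_convex G R C"
    and "pure_in G C"
    and "linear_cyclic_order (G\<lparr>carrier := C\<rparr>) R"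
  shows "elementarily_equivalent G R
    ((G Mod C) \<times>\<times> (G\<lparr>carrier := C\<rparr>))
    (lex_cyclic_order (quotient_cyclic_order R) (induced_order (G\<lparr>carrier := C\<rparr>) R))"
proof -
  interpret comm_group G by fact
  interpret cyclically_ordered_group G R by fact
  obtain U :: "nat filter" where U: "U \<noteq> bot" "U \<le> sequentially"
    "\<And>P. (\<forall>\<^sub>F i in U. P i) \<or> (\<forall>\<^sub>F i in U. \<not> P i)"
    using nonprincipal_ultrafilter_exists by blast
  have sub: "subgroup C G" using assms(3) subgroup_self unfolding c_convex_def by blast
  have conv: "g \<in> C"
    if "h \<in> C" "g \<in> carrier G" "R (inv\<^bsub>G\<^esub> h) \<one>\<^bsub>G\<^esub> h" "R \<one>\<^bsub>G\<^esub> g h" for h g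
    using assms(3) that unfolding c_convex_def by blast
  have "c_convex_subgroup G R C"
    by (intro c_convex_subgroup.intro c_convex_subgroup_axioms.intro assms(1,2,5) sub) (rule conv)
  then interpret pure_c_convex_subgroup G R C U
    by (intro pure_c_convex_subgroup.intro pure_c_convex_subgroup_axioms.intro assms(4) U)
  show ?thesis by (rule elementarily_equivalent_lex)
qed

end
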